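(* Let $\Omega \subset \mathbb{R}^d$ be a nonempty bounded open set, let $m \le d$, and let $g_1,\dots,g_m \in C^2(\bar\Omega;\mathbb{R}^d)$ be vector fields. Let $\lambda > 0$ and suppose the Poincaré inequality $$\int_\Omega |f(x)|^2\,dx \le \frac{1}{\lambda} \int_\Omega \sum_{i=1}^m |X_i f(x)|^2\,dx$$ holds for all $f \in WH^1_\perp(\Omega)$. Then for every $R > 0$ and every $y \in \Omega$, the set $\mathrm{Reach}^{-1}(B_R(y)) \subseteq \Omega$ of states that can reach the open ball $B_R(y)$ along trajectories in $\Omega$ of the control system $\dot\gamma(t) = \sum_{i=1}^m u_i(t) g_i(\gamma(t))$ has full Lebesgue measure in $\Omega$, i.e. $\Omega \setminus \mathrm{Reach}^{-1}(B_R(y))$ has Lebesgue measure zero.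
   Context: All functions are real-valued. $B_R(y)$ is the open Euclidean ball in $\mathbb{R}^d$ of radius $R$ centred at $y$. Derivatives along vector fields: write $g_i = (g_i^1,\dots,g_i^d)$. For smooth $h$, $X_i h = \sum_{j=1}^d g_i^j \partial_{x_j} h$ and $X_i^* h = -\sum_{j=1}^d \partial_{x_j}(g_i^j h)$. A function $f \in L^2(\Omega)$ has weak derivative $X_i f = w \in L^2(\Omega)$ along $g_i$ if $\int_\Omega w\,\phi\,dx = \int_\Omega f\, X_i^*\phi\,dx$ for all $\phi \in C_0^\infty(\Omega)$ (smooth functions compactly supported in $\Omega$). Horizontal Sobolev space: $WH^1(\Omega) = \{u \in L^2(\Omega) : X_i u \in L^2(\Omega),\ i = 1,\dots,m\}$, and $WH^1_\perp(\Omega) = \{u \in WH^1(\Omega) : \int_\Omega u\,dx = 0\}$. Reachability: a trajectory in $\Omega$ is an absolutely continuous curve $\gamma:[0,1]\to\mathbb{R}^d$ with $\dot\gamma \in L^2(0,1;\mathbb{R}^d)$ and $\gamma(t) \in \Omega$ for all $t \in [0,1]$, for which there is a control $u \in L^2(0,1;\mathbb{R}^m)$ with $\dot\gamma(t) = \sum_{i=1}^m u_i(t) g_i(\gamma(t))$ for a.e. $t \in (0,1)$. For $B \subseteq \mathbb{R}^d$, $\mathrm{Reach}^{-1}(B)$ is the set of $x \in \Omega$ for which there is a trajectory $\gamma$ in $\Omega$ with $\gamma(0) = x$ and $\gamma(1) \in B$. *)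

theory Defs
  imports "HOL-Analysis.Analysis"
begin

section \<open>Square-integrable functions\<close>

definition L2 :: "'a::euclidean_space set \<Rightarrow> ('a \<Rightarrow> 'b::euclidean_space) set" where
  "L2 S = {f. f \<in> borel_measurable (lebesgue_on S) \<and>
              integrable (lebesgue_on S) (\<lambda>x. (norm (f x))\<^sup>2)}"


section \<open>Classical derivatives\<close>

text \<open>A partial derivative is read off the Frechet derivative; below it is only ever applied at
  points where the function is differentiable, as ensured by \<open>Ck_on\<close>.\<close>

definition partial_deriv :: "'d::finite \<Rightarrow> (real^'d \<Rightarrow> real) \<Rightarrow> real^'d \<Rightarrow> real" where
  "partial_deriv j f x = frechet_derivative f (at x) (axis j 1)"

definition partial_derivs :: "'d::finite list \<Rightarrow> (real^'d \<Rightarrow> real) \<Rightarrow> real^'d \<Rightarrow> real" where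
  "partial_derivs js f = foldr partial_deriv js f"

text \<open>\<open>S\<close> is meant to be open.\<close>

definition Ck_on :: "nat \<Rightarrow> (real^'d::finite) set \<Rightarrow> (real^'d \<Rightarrow> real) \<Rightarrow> bool" where
  "Ck_on k S f \<longleftrightarrow>
     (\<forall>js. length js < k \<longrightarrow> partial_derivs js f differentiable_on S) \<and>
     (\<forall>js. length js \<le> k \<longrightarrow> continuous_on S (partial_derivs js f))"

text \<open>The class \<open>C\<^sup>k\<close> on the closure of an open set: \<open>C\<^sup>k\<close> inside, and every partial derivative of
  order at most \<open>k\<close> extends continuously to the closure; \<open>f\<close> itself (order zero) is such an
  extension.\<close>

definition Ck_on_closure :: "nat \<Rightarrow> (real^'d::finite) set \<Rightarrow> (real^'d \<Rightarrow> real) \<Rightarrow> bool" where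
  "Ck_on_closure k S f \<longleftrightarrow>
     Ck_on k S f \<and> continuous_on (closure S) f \<and>
     (\<forall>js. length js \<le> k \<longrightarrow>
        (\<exists>F. continuous_on (closure S) F \<and> (\<forall>x\<in>S. F x = partial_derivs js f x)))"

text \<open>Functions in \<open>C\<^sub>0\<^sup>\<infinity>(\<Omega>)\<close> are represented by their extension by zero to the whole space.\<close>

definition test_functions :: "(real^'d::finite) set \<Rightarrow> (real^'d \<Rightarrow> real) set" where
  "test_functions \<Omega> =
     {\<phi>. (\<forall>k. Ck_on k UNIV \<phi>) \<and>
         compact (closure {x. \<phi> x \<noteq> 0}) \<and> closure {x. \<phi> x \<noteq> 0} \<subseteq> \<Omega>}"


section \<open>Weak derivatives along vector fields and horizontal Sobolev spaces\<close>

definition adjoint_deriv :: "(real^'d::finite \<Rightarrow> real^'d) \<Rightarrow> (real^'d \<Rightarrow> real) \<Rightarrow> real^'d \<Rightarrow> real" where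
  "adjoint_deriv X h x = - (\<Sum>j\<in>UNIV. partial_deriv j (\<lambda>z. X z $ j * h z) x)"

text \<open>A relation rather than a function, because the weak derivative is determined only up to a
  null set.\<close>

definition has_weak_deriv_along ::
  "(real^'d::finite) set \<Rightarrow> (real^'d \<Rightarrow> real^'d) \<Rightarrow> (real^'d \<Rightarrow> real) \<Rightarrow> (real^'d \<Rightarrow> real) \<Rightarrow> bool" where
  "has_weak_deriv_along \<Omega> X f w \<longleftrightarrow>
     f \<in> L2 \<Omega> \<and> w \<in> L2 \<Omega> \<and>
     (\<forall>\<phi>\<in>test_functions \<Omega>.
        (LINT x|lebesgue_on \<Omega>. w x * \<phi> x) = (LINT x|lebesgue_on \<Omega>. f x * adjoint_deriv X \<phi> x))"

definition WH1 :: "(real^'d::finite) set \<Rightarrow> ('m::finite \<Rightarrow> real^'d \<Rightarrow> real^'d) \<Rightarrow> (real^'d \<Rightarrow> real) set" where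
  "WH1 \<Omega> g = {f \<in> L2 \<Omega>. \<forall>i. \<exists>w. has_weak_deriv_along \<Omega> (g i) f w}"

definition WH1_perp :: "(real^'d::finite) set \<Rightarrow> ('m::finite \<Rightarrow> real^'d \<Rightarrow> real^'d) \<Rightarrow> (real^'d \<Rightarrow> real) set" where
  "WH1_perp \<Omega> g = {f \<in> WH1 \<Omega> g. (LINT x|lebesgue_on \<Omega>. f x) = 0}"


section \<open>Trajectories and reachability\<close>

definition absolutely_continuous_on :: "real \<Rightarrow> real \<Rightarrow> (real \<Rightarrow> 'a::euclidean_space) \<Rightarrow> bool" where
  "absolutely_continuous_on a b \<gamma> \<longleftrightarrow>
     (\<forall>\<epsilon>>0. \<exists>\<delta>>0. \<forall>D. D division_of (\<Union>D) \<and> \<Union>D \<subseteq> {a..b} \<and> (\<Sum>K\<in>D. Sup K - Inf K) < \<delta> \<longrightarrow>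
        (\<Sum>K\<in>D. norm (\<gamma> (Sup K) - \<gamma> (Inf K))) < \<epsilon>)"

definition trajectory ::
  "(real^'d::finite) set \<Rightarrow> ('m::finite \<Rightarrow> real^'d \<Rightarrow> real^'d) \<Rightarrow> (real \<Rightarrow> real^'d) \<Rightarrow> bool" where
  "trajectory \<Omega> g \<gamma> \<longleftrightarrow>
     absolutely_continuous_on 0 1 \<gamma> \<and> (\<forall>t\<in>{0..1}. \<gamma> t \<in> \<Omega>) \<and>
     (\<exists>v\<in>L2 {0<..<1}. \<exists>u::real \<Rightarrow> real^'m. u \<in> L2 {0<..<1} \<and>
        (AE t in lebesgue_on {0<..<1}.
           (\<gamma> has_vector_derivative v t) (at t) \<and> v t = (\<Sum>i\<in>UNIV. u t $ i *\<^sub>R g i (\<gamma> t))))"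

definition Reach_inv ::
  "(real^'d::finite) set \<Rightarrow> ('m::finite \<Rightarrow> real^'d \<Rightarrow> real^'d) \<Rightarrow> (real^'d) set \<Rightarrow> (real^'d) set" where
  "Reach_inv \<Omega> g B = {x \<in> \<Omega>. \<exists>\<gamma>. trajectory \<Omega> g \<gamma> \<and> \<gamma> 0 = x \<and> \<gamma> 1 \<in> B}"

end

theory Submission
  imports Defs
begin

text \<open>
  Let \<open>A\<close> be the set of points from which \<open>B\<^sub>R(y)\<close> is reached by running, finitely many times and
  backwards in time, the flow of fields \<open>c \<phi> g\<^sub>i\<close> with \<open>\<phi> \<in> C\<^sub>0\<^sup>\<infinity>(\<Omega>)\<close> (\<open>backward_orbit\<close>). Such flows
  never leave \<open>\<Omega>\<close>, so \<open>A\<close> is contained in the set of states that can reach the ball; \<open>A\<close> is open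
  (\<open>open_backward_orbit\<close>), nonempty, and by construction invariant under these flows. Hence its
  indicator function is constant along every \<open>g\<^sub>i\<close> and should have weak derivative zero. The function
  \<open>1\<^sub>A - |A| / |\<Omega>|\<close> then lies in \<open>WH\<^sup>1\<^sub>\<bottom>(\<Omega>)\<close>, the Poincare inequality forces it to vanish almost
  everywhere, and as \<open>A\<close> has positive measure, \<open>A\<close> has full measure in \<open>\<Omega>\<close>.

  What has to be shown is that \<open>\<integral>\<^sub>A div k = 0\<close> for every \<open>k = \<phi> g\<^sub>i\<close>
  (\<open>integral_adjoint_deriv_eq_0\<close>). Write \<open>\<Psi>\<^sub>t\<close> for the time-one map of \<open>t k\<close> and
  \<open>T\<^sub>t x = x + t k(x)\<close>. Since \<open>k\<close> is \<open>C\<^sup>1\<close> with compact support, \<open>\<Psi>\<^sub>t - T\<^sub>t\<close> has Lipschitz constant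
  \<open>o(t)\<close> (\<open>time_one_map_linearization\<close>). So \<open>T\<^sub>t(A)\<close> is the image of \<open>\<Psi>\<^sub>t(A) \<subseteq> A\<close> under a map with
  Lipschitz constant \<open>1 + o(t)\<close>, and such a map enlarges volumes at most by a factor \<open>1 + o(t)\<close>
  (\<open>lipschitz_image_measure_le\<close>, from Vitali's covering theorem): \<open>|T\<^sub>t(A)| \<le> |A| + o(t)\<close>. On the other
  hand \<open>|T\<^sub>t(A)| = \<integral>\<^sub>A det (I + t Dk) = |A| + t \<integral>\<^sub>A div k + O(t\<^sup>2)\<close>
  (\<open>measure_image_perturbed_identity\<close>). Dividing by \<open>t\<close> gives \<open>\<integral>\<^sub>A div k \<le> 0\<close>
  (\<open>integral_divergence_nonpos\<close>), and the same argument for \<open>- k\<close> gives equality. Applied to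
  \<open>A = \<Omega>\<close>, it also shows that subtracting the mean of \<open>1\<^sub>A\<close> does not disturb the weak derivative.
\<close>

section \<open>Time-one maps of fields with small Lipschitz constant\<close>

definition integral_curve :: "('a::real_normed_vector \<Rightarrow> 'a) \<Rightarrow> (real \<Rightarrow> 'a) \<Rightarrow> bool" where
  "integral_curve k \<gamma> \<longleftrightarrow>
     (\<forall>s\<in>{0..1}. (\<gamma> has_vector_derivative k (\<gamma> s)) (at s within {0..1}))"

lemma integral_curve_continuous: "integral_curve k \<gamma> \<Longrightarrow> continuous_on {0..1} \<gamma>"
  unfolding integral_curve_def
  by (meson continuous_on_eq_continuous_within has_vector_derivative_continuous)

lemma unit_interval_increment_bound:
  fixes f :: "real \<Rightarrow> 'a::real_normed_vector"
  assumes "\<And>s. s \<in> {0..1} \<Longrightarrow> (f has_vector_derivative f' s) (at s within {0..1})"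
    and "\<And>s. s \<in> {0..1} \<Longrightarrow> norm (f' s) \<le> B" and "s \<in> {0..1}" "r \<in> {0..1}"
  shows "norm (f s - f r) \<le> B * \<bar>s - r\<bar>"
proof -
  have "norm (f s - f r) \<le> B * norm (s - r)"
    using assms
    by (intro differentiable_bound[where S="{0..1}" and f'="\<lambda>s h. h *\<^sub>R f' s"])
       (auto simp: has_vector_derivative_def mult.commute[of B] intro!: onorm_le mult_left_mono)
  then show ?thesis by simp
qed

text \<open>
  Picard iteration on the whole unit interval at once: the Lipschitz constant being below \<open>1\<close>, the
  integral operator contracts the supremum norm. The iteration lives on bounded continuous functions
  on the line, which form a complete space; times outside \<open>{0..1}\<close> are clamped into it.
\<close>

lemma integral_curve_exists:
  fixes k :: "'a::euclidean_space \<Rightarrow> 'a"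
  assumes lip: "L-lipschitz_on UNIV k" and "L < 1"
  shows "\<exists>\<gamma>. integral_curve k \<gamma> \<and> \<gamma> 0 = x"
proof -
  have L0: "0 \<le> L" using lip lipschitz_on_nonneg by blast
  have contk: "continuous_on UNIV k" using lip lipschitz_on_continuous_on by blast
  define step where "step f s = x + integral {0..s} (\<lambda>r. k (f r))" for f :: "real \<Rightarrow> 'a" and s
  have contkf: "continuous_on S (\<lambda>r. k (f r))" if "continuous_on S f" for f :: "real \<Rightarrow> 'a" and S
    using continuous_on_compose2[OF contk that] by auto
  have deriv: "(step f has_vector_derivative k (f s)) (at s within {0..1})"
    if "continuous_on {0..1} f" "s \<in> {0..1}" for f s
    unfolding step_def has_vector_derivative_add_const
    using integral_has_vector_derivative[OF contkf[OF that(1)] that(2)]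
    by (simp add: has_vector_derivative_def has_derivative_def)
  have "\<exists>g :: real \<Rightarrow>\<^sub>C 'a. \<forall>s. g s = step f (clamp 0 1 s)" for f :: "real \<Rightarrow>\<^sub>C 'a"
  proof -
    have "continuous_on (cbox 0 1) (step f)"
      by (auto simp: continuous_on_eq_continuous_within cbox_interval
          intro!: has_vector_derivative_continuous[OF deriv])
    from continuous_on_cbox_bcontfunE[OF this] show ?thesis by metis
  qed
  then obtain P :: "(real \<Rightarrow>\<^sub>C 'a) \<Rightarrow> real \<Rightarrow>\<^sub>C 'a" where P: "\<And>f s. P f s = step f (clamp 0 1 s)"
    by metis
  have "dist (P f) (P g) \<le> L * dist f g" for f g
  proof (rule dist_bound)
    fix s :: real
    define c :: real where "c = clamp 0 1 s"
    have c: "c \<in> {0..1}" using clamp_in_interval[of 0 1 s] by (simp add: c_def cbox_interval)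
    have int: "(\<lambda>r. k (f r)) integrable_on {0..c}" for f :: "real \<Rightarrow>\<^sub>C 'a"
      by (intro integrable_continuous_real contkf) auto
    have "norm (integral {0..c} (\<lambda>r. k (f r) - k (g r))) \<le> L * dist f g * (c - 0)"
    proof (rule integral_bound)
      fix r show "norm (k (f r) - k (g r)) \<le> L * dist f g"
        using lipschitz_onD[OF lip, of "f r" "g r"] dist_bounded[of f r g] L0
        by (simp add: dist_norm) (meson mult_left_mono order_trans)
    qed (use c in \<open>auto intro!: continuous_intros contkf\<close>)
    also have "\<dots> \<le> L * dist f g" using c L0 by (simp add: mult_left_le)
    finally show "dist (P f s) (P g s) \<le> L * dist f g"
      unfolding P step_def c_def[symmetric] integral_diff[OF int[of f] int[of g]]
      by (simp add: dist_norm)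
  qed
  then obtain f where f: "P f = f"
    using banach_fix_type[of L P] L0 \<open>L < 1\<close> by blast
  have "f s = step f s" if "s \<in> {0..1}" for s
    using P[of f s] that f by (simp add: cbox_interval clamp_cancel_cbox)
  then have "(f has_vector_derivative k (f s)) (at s within {0..1})" if "s \<in> {0..1}" for s
    using that deriv[of f s]
    by (intro has_vector_derivative_transform[OF that, of f "step f"]) auto
  moreover have "f 0 = x"
    using P[of f 0] f by (simp add: cbox_interval clamp_cancel_cbox step_def)
  ultimately show ?thesis unfolding integral_curve_def by blast
qed

text \<open>
  At the time where the distance of the two curves is maximal, it exceeds the distance at time \<open>r\<close>
  by at most \<open>L\<close> times this maximum. Taking \<open>r = 0\<close> and \<open>r = 1\<close> bounds the time-one map and its inverse.
\<close>

lemma integral_curves_distance: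
  fixes k :: "'a::euclidean_space \<Rightarrow> 'a"
  assumes lip: "L-lipschitz_on UNIV k" and "L < 1"
    and \<gamma>: "integral_curve k \<gamma>" and \<gamma>': "integral_curve k \<gamma>'"
    and s: "s \<in> {0..1}" and r: "r \<in> {0..1}"
  shows "(1 - L) * norm (\<gamma> s - \<gamma>' s) \<le> norm (\<gamma> r - \<gamma>' r)"
proof -
  have L0: "0 \<le> L" using lip lipschitz_on_nonneg by blast
  have cont: "continuous_on {0..1} (\<lambda>q. norm (\<gamma> q - \<gamma>' q))"
    by (intro continuous_intros integral_curve_continuous[OF \<gamma>] integral_curve_continuous[OF \<gamma>'])
  obtain m where m: "m \<in> {0..1}" and max: "\<And>q. q \<in> {0..1} \<Longrightarrow> norm (\<gamma> q - \<gamma>' q) \<le> norm (\<gamma> m - \<gamma>' m)"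
    using continuous_attains_sup[OF compact_Icc _ cont] by (metis s empty_iff)
  have "norm ((\<gamma> m - \<gamma>' m) - (\<gamma> r - \<gamma>' r)) \<le> (L * norm (\<gamma> m - \<gamma>' m)) * \<bar>m - r\<bar>"
  proof (rule unit_interval_increment_bound[OF _ _ m r])
    show "((\<lambda>q. \<gamma> q - \<gamma>' q) has_vector_derivative k (\<gamma> q) - k (\<gamma>' q)) (at q within {0..1})"
      if "q \<in> {0..1}" for q
      using that \<gamma> \<gamma>' unfolding integral_curve_def by (auto intro!: derivative_intros)
    show "norm (k (\<gamma> q) - k (\<gamma>' q)) \<le> L * norm (\<gamma> m - \<gamma>' m)" if "q \<in> {0..1}" for q
      using lipschitz_onD[OF lip, of "\<gamma> q" "\<gamma>' q"] mult_left_mono[OF max[OF that] L0]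
      by (simp add: dist_norm)
  qed
  also have "\<dots> \<le> L * norm (\<gamma> m - \<gamma>' m)"
    using m r L0 by (intro mult_left_le) auto
  finally have "(1 - L) * norm (\<gamma> m - \<gamma>' m) \<le> norm (\<gamma> r - \<gamma>' r)"
    using norm_triangle_ineq2[of "\<gamma> m - \<gamma>' m" "\<gamma> r - \<gamma>' r"] by (simp add: algebra_simps)
  moreover have "(1 - L) * norm (\<gamma> s - \<gamma>' s) \<le> (1 - L) * norm (\<gamma> m - \<gamma>' m)"
    using max[OF s] \<open>L < 1\<close> by simp
  ultimately show ?thesis by linarith
qed

text \<open>
  A point outside \<open>S\<close> is a rest point; a curve passing through it coincides with the constant
  curve by \<open>integral_curves_distance\<close> and so cannot have started in \<open>S\<close>.
\<close>

lemma integral_curve_stays_in: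
  fixes k :: "'a::euclidean_space \<Rightarrow> 'a"
  assumes lip: "L-lipschitz_on UNIV k" and "L < 1"
    and \<gamma>: "integral_curve k \<gamma>" and "\<And>x. x \<notin> S \<Longrightarrow> k x = 0"
    and "\<gamma> 0 \<in> S" "s \<in> {0..1}"
  shows "\<gamma> s \<in> S"
proof (rule ccontr)
  assume "\<gamma> s \<notin> S"
  then have "integral_curve k (\<lambda>_. \<gamma> s)" 
    unfolding integral_curve_def using assms(4) by (auto intro!: derivative_eq_intros)
  from integral_curves_distance[OF lip \<open>L < 1\<close> \<gamma> this, of 0 s] assms(6) \<open>L < 1\<close>
  have "\<gamma> 0 = \<gamma> s" by (simp add: mult_le_0_iff)
  then show False using \<open>\<gamma> s \<notin> S\<close> \<open>\<gamma> 0 \<in> S\<close> by simp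
qed

definition time_one_map :: "('a::real_normed_vector \<Rightarrow> 'a) \<Rightarrow> 'a \<Rightarrow> 'a" where
  "time_one_map k x = (SOME \<gamma>. integral_curve k \<gamma> \<and> \<gamma> 0 = x) 1"

lemma time_one_mapE:
  fixes k :: "'a::euclidean_space \<Rightarrow> 'a"
  assumes "L-lipschitz_on UNIV k" "L < 1"
  obtains \<gamma> where "integral_curve k \<gamma>" "\<gamma> 0 = x" "\<gamma> 1 = time_one_map k x"
  using someI_ex[OF integral_curve_exists[OF assms, of x]] unfolding time_one_map_def by blast

lemma time_one_map_lipschitz:
  fixes k :: "'a::euclidean_space \<Rightarrow> 'a"
  assumes "L-lipschitz_on UNIV k" "L < 1"
  shows "(1 - L) * norm (time_one_map k x - time_one_map k y) \<le> norm (x - y)"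
    and "(1 - L) * norm (x - y) \<le> norm (time_one_map k x - time_one_map k y)"
proof -
  obtain \<gamma> where \<gamma>: "integral_curve k \<gamma>" "\<gamma> 0 = x" "\<gamma> 1 = time_one_map k x"
    using time_one_mapE[OF assms] .
  obtain \<gamma>' where \<gamma>': "integral_curve k \<gamma>'" "\<gamma>' 0 = y" "\<gamma>' 1 = time_one_map k y"
    using time_one_mapE[OF assms] .
  show "(1 - L) * norm (time_one_map k x - time_one_map k y) \<le> norm (x - y)"
    using integral_curves_distance[OF assms \<gamma>(1) \<gamma>'(1), of 1 0] \<gamma> \<gamma>' by simp
  show "(1 - L) * norm (x - y) \<le> norm (time_one_map k x - time_one_map k y)"
    using integral_curves_distance[OF assms \<gamma>(1) \<gamma>'(1), of 0 1] \<gamma> \<gamma>' by simp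
qed

text \<open>
  The time-one map is continuous and injective, so invariance of domain applies.
\<close>

lemma open_image_time_one_map:
  fixes k :: "'a::euclidean_space \<Rightarrow> 'a"
  assumes lip: "L-lipschitz_on UNIV k" "L < 1" and "open U"
  shows "open (time_one_map k ` U)"
proof (rule invariance_of_domain[OF _ \<open>open U\<close>])
  have "(1 / (1 - L))-lipschitz_on U (time_one_map k)"
    using time_one_map_lipschitz(1)[OF lip] lip(2)
    by (intro lipschitz_onI) (auto simp: dist_norm field_simps)
  then show "continuous_on U (time_one_map k)" by (rule lipschitz_on_continuous_on)
  show "inj_on (time_one_map k) U"
  proof (rule inj_onI)
    fix x y assume "time_one_map k x = time_one_map k y"
    then show "x = y" using time_one_map_lipschitz(2)[OF lip, of x y] lip(2)
      by (simp add: mult_le_0_iff)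
  qed
qed

section \<open>Volume of Lipschitz images\<close>

text \<open>
  Up to a null set, \<open>U\<close> is a disjoint union of balls, and a ball of radius \<open>r\<close> is mapped into a ball of
  radius \<open>L r\<close>, whose volume is \<open>L\<^sup>n\<close> times larger. Using balls makes the constant sharp,
  which matters because it is applied with \<open>L\<close> close to \<open>1\<close>.
\<close>

lemma lipschitz_image_measure_le:
  fixes f :: "'a::euclidean_space \<Rightarrow> 'b::euclidean_space"
  assumes dim: "DIM('b) = DIM('a)" and lip: "L-lipschitz_on U f"
    and "open U" and meas: "f ` U \<in> sets lebesgue"
  shows "emeasure lebesgue (f ` U) \<le> ennreal (L ^ DIM('a)) * emeasure lebesgue U"
proof -
  have L0: "0 \<le> L" using lip lipschitz_on_nonneg by blast
  define K :: "('a \<times> real) set" where "K = {p. snd p > 0 \<and> cball (fst p) (snd p) \<subseteq> U}"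
  have "\<exists>p. p \<in> K \<and> x \<in> cball (fst p) (snd p) \<and> snd p < d" if x: "x \<in> U" and "0 < d" for x d
  proof -
    obtain e where "e > 0" "cball x e \<subseteq> U"
      using \<open>open U\<close> x open_contains_cball by blast
    then show ?thesis using \<open>0 < d\<close>
      by (intro exI[of _ "(x, min e (d/2))"]) (auto simp: K_def subset_iff)
  qed
  note K = this
  obtain C where C: "countable C" "C \<subseteq> K"
    and disj: "pairwise (\<lambda>i j. disjnt (cball (fst i) (snd i)) (cball (fst j) (snd j))) C"
    and negl: "negligible (U - (\<Union>p\<in>C. cball (fst p) (snd p)))"
    by (rule Vitali_covering_theorem_cballs[of K snd U fst, OF _ K]) (simp_all add: K_def)
  \<comment> \<open>The countable family is enumerated by natural numbers, with empty sets as padding.\<close>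
  define D where "D n = (if n \<in> to_nat_on C ` C
     then cball (fst (from_nat_into C n)) (snd (from_nat_into C n)) else {})" for n
  define E where "E n = (if n \<in> to_nat_on C ` C
     then cball (f (fst (from_nat_into C n))) (L * snd (from_nat_into C n)) else {})" for n
  let ?N = "U - (\<Union>p\<in>C. cball (fst p) (snd p))"
  have neglf: "negligible (f ` ?N)"
  proof (rule negligible_locally_Lipschitz_image[OF _ negl])
    fix x assume "x \<in> ?N"
    then show "\<exists>T B. open T \<and> x \<in> T \<and> (\<forall>y \<in> ?N \<inter> T. norm (f y - f x) \<le> B * norm (y - x))"
      using lipschitz_onD[OF lip] by (intro exI[of _ UNIV] exI[of _ L]) (auto simp: dist_norm)
  qed (simp add: dim)
  have sub: "f ` U \<subseteq> f ` ?N \<union> (\<Union>p\<in>C. cball (f (fst p)) (L * snd p))"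
  proof clarify
    fix x assume x: "x \<in> U" "f x \<notin> (\<Union>p\<in>C. cball (f (fst p)) (L * snd p))"
    have "x \<notin> cball (fst p) (snd p)" if "p \<in> C" for p
    proof
      assume xp: "x \<in> cball (fst p) (snd p)"
      have "fst p \<in> U" using that C(2) by (force simp: K_def)
      then have "dist (f (fst p)) (f x) \<le> L * snd p"
        using lipschitz_onD[OF lip, of "fst p" x] x(1) xp mult_left_mono[OF _ L0, of "dist (fst p) x" "snd p"]
        by simp
      then show False using x(2) that by auto
    qed
    then show "f x \<in> f ` ?N" using x(1) by blast
  qed
  have "emeasure lebesgue (f ` U) \<le> emeasure lebesgue (f ` ?N \<union> (\<Union>p\<in>C. cball (f (fst p)) (L * snd p)))"
    using C(1) neglf by (intro emeasure_mono sub sets.Un sets.countable_UN')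
       (auto dest: negligible_imp_sets)
  also have "\<dots> \<le> emeasure lebesgue (f ` ?N) + emeasure lebesgue (\<Union>p\<in>C. cball (f (fst p)) (L * snd p))"
    using C(1) neglf by (intro emeasure_subadditive sets.countable_UN')
       (auto dest: negligible_imp_sets)
  also have "emeasure lebesgue (f ` ?N) = 0"
    using neglf negligible_iff_null_sets by blast
  also have "(\<Union>p\<in>C. cball (f (fst p)) (L * snd p)) = (\<Union>n. E n)"
    using C(1) by (force simp: E_def)
  also have "0 + emeasure lebesgue (\<Union>n. E n) \<le> (\<Sum>n. emeasure lebesgue (E n))"
    unfolding add_0 by (rule emeasure_subadditive_countably) (auto simp: E_def)
  also have "(\<lambda>n. emeasure lebesgue (E n)) = (\<lambda>n. ennreal (L ^ DIM('a)) * emeasure lebesgue (D n))"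
  proof
    fix n
    show "emeasure lebesgue (E n) = ennreal (L ^ DIM('a)) * emeasure lebesgue (D n)"
    proof (cases "n \<in> to_nat_on C ` C")
      case True
      then have "snd (from_nat_into C n) > 0" using C by (auto simp: K_def)
      then show ?thesis using L0 True
        by (simp add: D_def E_def emeasure_cball dim power_mult_distrib ennreal_mult' mult_ac)
    qed (simp add: D_def E_def)
  qed
  also have "(\<Sum>n. ennreal (L ^ DIM('a)) * emeasure lebesgue (D n))
      = ennreal (L ^ DIM('a)) * (\<Sum>n. emeasure lebesgue (D n))"
    by (rule ennreal_suminf_cmult)
  also have "(\<Sum>n. emeasure lebesgue (D n)) = emeasure lebesgue (\<Union>n. D n)"
  proof (rule suminf_emeasure)
    show "disjoint_family D"
      using disj C(1) by (fastforce simp: disjoint_family_on_def D_def pairwise_def disjnt_def)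
  qed (auto simp: D_def)
  also have "\<dots> \<le> emeasure lebesgue U"
    using C \<open>open U\<close> by (intro emeasure_mono) (auto simp: K_def D_def subset_iff)
  finally show ?thesis by (simp add: mult_left_mono)
qed

section \<open>First-order expansion of a time-one map\<close>

text \<open>
  For two curves \<open>\<gamma>\<close>, \<open>\<gamma>'\<close> starting at \<open>a\<close>, \<open>b\<close>, the claim integrates the bound \<open>main\<close> on
  \<open>(k(\<gamma> s) - k(\<gamma>' s)) - (k a - k b)\<close>. To see a factor \<open>norm (a - b)\<close> in that second difference although
  \<open>k'\<close> is merely uniformly continuous, one must run along the segment from \<open>b\<close> to \<open>a\<close>, comparing \<open>k\<close>
  at the shifted and the unshifted point, and not along the short displacements \<open>\<gamma> s - a\<close>, \<open>\<gamma>' s - b\<close>.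
\<close>

lemma time_one_map_linearization:
  fixes k :: "'a::euclidean_space \<Rightarrow> 'a"
  assumes deriv: "\<And>x. (k has_derivative k' x) (at x)"
    and bound: "\<And>x v. norm (k' x v) \<le> K * norm v" and kK: "\<And>x. norm (k x) \<le> K"
    and unif: "\<And>x x' v. norm (x - x') < \<delta> \<Longrightarrow> norm (k' x v - k' x' v) \<le> \<epsilon> * norm v"
    and t: "0 \<le> t" "t * K \<le> 1/2" "t * K < \<delta>"
  shows "norm ((time_one_map (\<lambda>x. t *\<^sub>R k x) a - (a + t *\<^sub>R k a)) 
             - (time_one_map (\<lambda>x. t *\<^sub>R k x) b - (b + t *\<^sub>R k b)))
           \<le> t * (\<epsilon> + 2 * t * K\<^sup>2) * norm (a - b)"
proof -
  have K0: "0 \<le> K" using kK[of a] norm_ge_zero order_trans by blast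
  have kL: "norm (k x - k x') \<le> K * norm (x - x')" for x x'
    by (rule differentiable_bound[of UNIV k k']) (use deriv bound in \<open>auto intro!: onorm_le\<close>)
  have lip: "(t * K)-lipschitz_on UNIV (\<lambda>x. t *\<^sub>R k x)"
    using t(1) K0 kL
    by (intro lipschitz_onI) 
       (auto simp: dist_norm scaleR_diff_right[symmetric] mult.assoc intro!: mult_left_mono)
  have "t * K < 1" using t(2) by simp
  obtain \<gamma> where \<gamma>: "integral_curve (\<lambda>x. t *\<^sub>R k x) \<gamma>" "\<gamma> 0 = a" "\<gamma> 1 = time_one_map (\<lambda>x. t *\<^sub>R k x) a"
    using time_one_mapE[OF lip \<open>t * K < 1\<close>] .
  obtain \<gamma>' where \<gamma>': "integral_curve (\<lambda>x. t *\<^sub>R k x) \<gamma>'" "\<gamma>' 0 = b" "\<gamma>' 1 = time_one_map (\<lambda>x. t *\<^sub>R k x) b"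
    using time_one_mapE[OF lip \<open>t * K < 1\<close>] .
  have close: "norm (\<gamma> s - \<gamma>' s) \<le> 2 * norm (a - b)" if "s \<in> {0..1}" for s
  proof -
    have "1/2 * norm (\<gamma> s - \<gamma>' s) \<le> (1 - t * K) * norm (\<gamma> s - \<gamma>' s)"
      using t(2) by (intro mult_right_mono) auto
    also have "\<dots> \<le> norm (a - b)"
      using integral_curves_distance[OF lip \<open>t * K < 1\<close> \<gamma>(1) \<gamma>'(1) that, of 0] \<gamma> \<gamma>' by simp
    finally show ?thesis by simp
  qed
  have short: "norm (\<gamma> s - \<gamma> 0) \<le> t * K" if "integral_curve (\<lambda>x. t *\<^sub>R k x) \<gamma>" "s \<in> {0..1}" for \<gamma> s
  proof -
    have "norm (\<gamma> s - \<gamma> 0) \<le> t * K * \<bar>s - 0\<bar>"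
      using that kK t(1) unfolding integral_curve_def
      by (intro unit_interval_increment_bound[where f'="\<lambda>s. t *\<^sub>R k (\<gamma> s)"])
         (auto intro: mult_left_mono)
    also have "\<dots> \<le> t * K" using that t(1) K0 by (intro mult_left_le) auto
    finally show ?thesis .
  qed
  have drift: "norm ((\<gamma> s - \<gamma>' s) - (a - b)) \<le> 2 * t * K * norm (a - b)" if s: "s \<in> {0..1}" for s
  proof -
    have "norm ((\<gamma> s - \<gamma>' s) - (\<gamma> 0 - \<gamma>' 0)) \<le> t * (K * (2 * norm (a - b))) * \<bar>s - 0\<bar>"
    proof (rule unit_interval_increment_bound[OF _ _ s])
      show "((\<lambda>q. \<gamma> q - \<gamma>' q) has_vector_derivative t *\<^sub>R k (\<gamma> q) - t *\<^sub>R k (\<gamma>' q)) (at q within {0..1})"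
        if "q \<in> {0..1}" for q
        using that \<gamma>(1) \<gamma>'(1) unfolding integral_curve_def by (auto intro!: derivative_intros)
      show "norm (t *\<^sub>R k (\<gamma> q) - t *\<^sub>R k (\<gamma>' q)) \<le> t * (K * (2 * norm (a - b)))"
        if "q \<in> {0..1}" for q
        using kL[of "\<gamma> q" "\<gamma>' q"] mult_left_mono[OF close[OF that] K0] t(1)
        by (simp add: scaleR_diff_right[symmetric] mult_left_mono)
    qed simp
    also have "\<dots> \<le> t * (K * (2 * norm (a - b)))"
      using s t(1) K0 by (intro mult_left_le) auto
    finally show ?thesis using \<gamma> \<gamma>' by (simp add: mult_ac)
  qed
  have main: "norm ((k (\<gamma> s) - k (\<gamma>' s)) - (k a - k b)) \<le> (\<epsilon> + 2 * t * K\<^sup>2) * norm (a - b)"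
    if s: "s \<in> {0..1}" for s
  proof -
    define u where "u = \<gamma> s - a"
    define v where "v = \<gamma>' s - b"
    \<comment> \<open>\<open>c\<close> runs along the segment from \<open>b\<close> to \<open>a\<close>, and \<open>w\<close> interpolates the displacements of the two curves.\<close>
    define c where "c \<theta> = b + \<theta> *\<^sub>R (a - b)" for \<theta> :: real
    define w where "w \<theta> = v + \<theta> *\<^sub>R (u - v)" for \<theta> :: real
    have u: "norm u \<le> t * K" and v: "norm v \<le> t * K"
      using short[OF \<gamma>(1) s] short[OF \<gamma>'(1) s] \<gamma> \<gamma>' by (auto simp: u_def v_def)
    have uv: "norm (u - v) \<le> 2 * t * K * norm (a - b)"
      using drift[OF s] by (simp add: u_def v_def algebra_simps)
    define p' where "p' \<theta> = k' (c \<theta> + w \<theta>) ((a - b) + (u - v)) - k' (c \<theta>) (a - b)" for \<theta>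
    have "norm ((k (c 1 + w 1) - k (c 1)) - (k (c 0 + w 0) - k (c 0)))
        \<le> (\<epsilon> + 2 * t * K\<^sup>2) * norm (a - b) * \<bar>1 - 0\<bar>"
    proof (rule unit_interval_increment_bound)
      fix \<theta> :: real assume \<theta>: "\<theta> \<in> {0..1}"
      have lin: "h *\<^sub>R k' x v = k' x (h *\<^sub>R v)" for h x v
        using linear_cmul[OF has_derivative_linear[OF deriv]] by simp
      have d1: "((\<lambda>\<theta>. k (c \<theta> + w \<theta>)) has_derivative (\<lambda>h. h *\<^sub>R k' (c \<theta> + w \<theta>) ((a - b) + (u - v)))) (at \<theta> within {0..1})"
        unfolding lin by (rule has_derivative_compose[OF _ deriv])
           (auto simp: c_def w_def scaleR_add_right intro!: derivative_eq_intros)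
      have d2: "((\<lambda>\<theta>. k (c \<theta>)) has_derivative (\<lambda>h. h *\<^sub>R k' (c \<theta>) (a - b))) (at \<theta> within {0..1})"
        unfolding lin by (rule has_derivative_compose[OF _ deriv])
           (auto simp: c_def intro!: derivative_eq_intros)
      show "((\<lambda>\<theta>. k (c \<theta> + w \<theta>) - k (c \<theta>)) has_vector_derivative p' \<theta>) (at \<theta> within {0..1})"
        using has_derivative_diff[OF d1 d2]
        unfolding has_vector_derivative_def p'_def scaleR_diff_right .
      have "w \<theta> = (1 - \<theta>) *\<^sub>R v + \<theta> *\<^sub>R u" by (simp add: w_def algebra_simps)
      then have "norm (w \<theta>) \<le> (1 - \<theta>) * norm v + \<theta> * norm u"
        using \<theta> norm_triangle_ineq[of "(1 - \<theta>) *\<^sub>R v" "\<theta> *\<^sub>R u"] by simp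
      also have "\<dots> \<le> (1 - \<theta>) * (t * K) + \<theta> * (t * K)"
        using \<theta> u v by (intro add_mono mult_left_mono) auto
      also have "\<dots> < \<delta>" using t(3) by (simp add: algebra_simps)
      finally have w: "norm ((c \<theta> + w \<theta>) - c \<theta>) < \<delta>" by simp
      have "p' \<theta> = (k' (c \<theta> + w \<theta>) (a - b) - k' (c \<theta>) (a - b)) + k' (c \<theta> + w \<theta>) (u - v)"
        unfolding p'_def linear_add[OF has_derivative_linear[OF deriv]] by simp
      then have "norm (p' \<theta>) \<le> norm (k' (c \<theta> + w \<theta>) (a - b) - k' (c \<theta>) (a - b)) + norm (k' (c \<theta> + w \<theta>) (u - v))"
        by (metis norm_triangle_ineq)
      also have "\<dots> \<le> \<epsilon> * norm (a - b) + K * (2 * t * K * norm (a - b))"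
        using unif[OF w] bound[of "c \<theta> + w \<theta>" "u - v"] mult_left_mono[OF uv K0] by (intro add_mono) auto
      finally show "norm (p' \<theta>) \<le> (\<epsilon> + 2 * t * K\<^sup>2) * norm (a - b)"
        by (simp add: algebra_simps power2_eq_square)
    qed auto
    moreover have "c 1 + w 1 = \<gamma> s" "c 1 = a" "c 0 + w 0 = \<gamma>' s" "c 0 = b"
      by (auto simp: c_def w_def u_def v_def)
    ultimately show ?thesis by (simp add: algebra_simps)
  qed
  let ?f = "\<lambda>s. (\<gamma> s - s *\<^sub>R (t *\<^sub>R k a)) - (\<gamma>' s - s *\<^sub>R (t *\<^sub>R k b))"
  have "norm (?f 1 - ?f 0) \<le> t * ((\<epsilon> + 2 * t * K\<^sup>2) * norm (a - b)) * \<bar>1 - 0\<bar>"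
  proof (rule unit_interval_increment_bound)
    show "(?f has_vector_derivative t *\<^sub>R ((k (\<gamma> s) - k (\<gamma>' s)) - (k a - k b))) (at s within {0..1})"
      if "s \<in> {0..1}" for s
      using that \<gamma>(1) \<gamma>'(1) unfolding integral_curve_def 
      by (auto intro!: derivative_eq_intros simp: algebra_simps)
    show "norm (t *\<^sub>R ((k (\<gamma> s) - k (\<gamma>' s)) - (k a - k b))) \<le> t * ((\<epsilon> + 2 * t * K\<^sup>2) * norm (a - b))"
      if "s \<in> {0..1}" for s
      using mult_left_mono[OF main[OF that] t(1)] t(1) by simp
  qed auto
  then show ?thesis using \<gamma> \<gamma>' by (simp add: algebra_simps)
qed

section \<open>First-order expansion of the determinant\<close>

text \<open>
  The constant depends on the size of \<open>I\<close> and on \<open>K\<close> only, which is what makes it uniform over all points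
  when this is applied to the diagonal of a bounded matrix field.
\<close>

lemma prod_one_plus_linearization:
  assumes "finite I" "0 \<le> K"
  shows "\<exists>C\<ge>0. \<forall>m t::real. (\<forall>i\<in>I. \<bar>m i\<bar> \<le> K) \<longrightarrow> 0 \<le> t \<longrightarrow> t \<le> 1 \<longrightarrow>
           \<bar>(\<Prod>i\<in>I. 1 + t * m i) - 1 - t * (\<Sum>i\<in>I. m i)\<bar> \<le> C * t\<^sup>2"
  using \<open>finite I\<close>
proof induction
  case empty
  then show ?case by (intro exI[of _ 0]) auto
next
  case (insert j I)
  then obtain C where C: "C \<ge> 0" and bd: "\<And>m t::real. (\<forall>i\<in>I. \<bar>m i\<bar> \<le> K) \<Longrightarrow> 0 \<le> t \<Longrightarrow> t \<le> 1 \<Longrightarrow>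
           \<bar>(\<Prod>i\<in>I. 1 + t * m i) - 1 - t * (\<Sum>i\<in>I. m i)\<bar> \<le> C * t\<^sup>2"
    by blast
  have "\<bar>(\<Prod>i\<in>insert j I. 1 + t * m i) - 1 - t * (\<Sum>i\<in>insert j I. m i)\<bar> \<le> (C * (1 + K) + card I * K * K) * t\<^sup>2"
    if m: "\<forall>i\<in>insert j I. \<bar>m i\<bar> \<le> K" and t: "0 \<le> t" "t \<le> 1" for m and t :: real
  proof -
    define P where "P = (\<Prod>i\<in>I. 1 + t * m i)"
    define S where "S = (\<Sum>i\<in>I. m i)"
    have IH: "\<bar>P - 1 - t * S\<bar> \<le> C * t\<^sup>2" unfolding P_def S_def using m t by (intro bd) auto
    have mj: "\<bar>m j\<bar> \<le> K" using m by simp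
    have S: "\<bar>S\<bar> \<le> card I * K"
      unfolding S_def using m by (intro order_trans[OF sum_abs] sum_bounded_above) auto
    have "t * \<bar>m j\<bar> \<le> 1 * K" using t mj by (intro mult_mono) auto
    then have tm: "\<bar>1 + t * m j\<bar> \<le> 1 + K" using abs_triangle_ineq[of 1 "t * m j"] t by (simp add: abs_mult)
    have "(1 + t * m j) * P - 1 - t * (m j + S) = (P - 1 - t * S) * (1 + t * m j) + t\<^sup>2 * (S * m j)"
      by (simp add: algebra_simps power2_eq_square)
    also have "\<bar>\<dots>\<bar> \<le> \<bar>P - 1 - t * S\<bar> * \<bar>1 + t * m j\<bar> + t\<^sup>2 * (\<bar>S\<bar> * \<bar>m j\<bar>)"
      by (rule order_trans[OF abs_triangle_ineq]) (simp add: abs_mult)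
    also have "\<dots> \<le> C * t\<^sup>2 * (1 + K) + t\<^sup>2 * (card I * K * K)"
      using IH tm S mj C \<open>0 \<le> K\<close> by (intro add_mono mult_mono) auto
    finally show ?thesis
      using insert.hyps by (simp add: P_def S_def algebra_simps)
  qed
  then show ?case using C \<open>0 \<le> K\<close>
    by (intro exI[of _ "C * (1 + K) + card I * K * K"]) auto
qed

text \<open>
  In the Leibniz formula the identity permutation contributes \<open>1 + t trace M + O(t\<^sup>2)\<close>; every other
  permutation moves at least two indices and so contributes two off-diagonal factors of size \<open>t\<close>.
\<close>

lemma det_identity_plus_linearization:
  assumes "0 \<le> K"
  shows "\<exists>C\<ge>0. \<forall>(M :: real^'n::finite^'n) t. (\<forall>i j. \<bar>M $ i $ j\<bar> \<le> K) \<longrightarrow> 0 \<le> t \<longrightarrow> t \<le> 1 \<longrightarrow>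
           \<bar>det (mat 1 + t *\<^sub>R M) - 1 - t * trace M\<bar> \<le> C * t\<^sup>2"
proof -
  obtain C where C: "C \<ge> 0" and bd: "\<And>(m :: 'n \<Rightarrow> real) t. (\<forall>i. \<bar>m i\<bar> \<le> K) \<Longrightarrow> 0 \<le> t \<Longrightarrow> t \<le> 1 \<Longrightarrow>
           \<bar>(\<Prod>i\<in>UNIV. 1 + t * m i) - 1 - t * (\<Sum>i\<in>UNIV. m i)\<bar> \<le> C * t\<^sup>2"
    using prod_one_plus_linearization[of "UNIV :: 'n set" K] assms by auto
  define Q where "Q = {p. p permutes (UNIV :: 'n set)} - {id}"
  have finQ: "finite {p. p permutes (UNIV :: 'n set)}" by (rule finite_permutations) simp
  have "\<bar>det (mat 1 + t *\<^sub>R M) - 1 - t * trace M\<bar> \<le> (C + card Q * (1 + K) ^ CARD('n)) * t\<^sup>2"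
    if M: "\<forall>i j. \<bar>M $ i $ j\<bar> \<le> K" and t: "0 \<le> t" "t \<le> 1" for M :: "real^'n^'n" and t :: real
  proof -
    define A where "A = mat 1 + t *\<^sub>R M"
    have entry: "\<bar>A $ i $ j\<bar> \<le> (1 + K) * (if j = i then 1 else t)" for i j
    proof -
      have "t * \<bar>M $ i $ j\<bar> \<le> t * K" using M t by (intro mult_left_mono) auto
      moreover have "t * K \<le> K" using t assms by (simp add: mult_left_le_one_le)
      moreover have "\<bar>1 + t * M $ i $ j\<bar> \<le> 1 + t * \<bar>M $ i $ j\<bar>"
        using abs_triangle_ineq[of 1 "t * M $ i $ j"] t by (simp add: abs_mult)
      ultimately show ?thesis using t by (auto simp: A_def mat_def abs_mult algebra_simps)
    qed
    have off: "\<bar>\<Prod>i\<in>UNIV. A $ i $ p i\<bar> \<le> (1 + K) ^ CARD('n) * t\<^sup>2" if p: "p \<in> Q" for p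
    proof -
      have inj: "inj p" using p by (auto simp: Q_def permutes_inj)
      obtain a where a: "p a \<noteq> a" using p by (auto simp: Q_def id_def fun_eq_iff)
      then have "p (p a) \<noteq> p a" using inj by (auto dest: injD)
      with a have "card {a, p a} \<le> card {i. p i \<noteq> i}" by (intro card_mono) auto
      then have two: "2 \<le> card {i. p i \<noteq> i}" using a by simp
      have "\<bar>\<Prod>i\<in>UNIV. A $ i $ p i\<bar> \<le> (\<Prod>i\<in>UNIV. (1 + K) * (if p i = i then 1 else t))"
        unfolding abs_prod by (intro prod_mono) (use entry in auto)
      also have "\<dots> = (1 + K) ^ CARD('n) * t ^ card {i. p i \<noteq> i}"
        by (simp add: prod.distrib prod.If_cases Collect_neg_eq[symmetric])
      also have "\<dots> \<le> (1 + K) ^ CARD('n) * t\<^sup>2"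
        using two t assms by (intro mult_left_mono power_decreasing) auto
      finally show ?thesis .
    qed
    have "det A = (\<Prod>i\<in>UNIV. A $ i $ i) + (\<Sum>p\<in>Q. of_int (sign p) * (\<Prod>i\<in>UNIV. A $ i $ p i))"
      unfolding det_def Q_def using finQ by (subst sum.remove[of _ id]) (auto simp: permutes_id)
    also have "(\<Prod>i\<in>UNIV. A $ i $ i) = (\<Prod>i\<in>UNIV. 1 + t * M $ i $ i)" by (simp add: A_def mat_def)
    finally have "\<bar>det A - 1 - t * trace M\<bar> \<le> 
        \<bar>(\<Prod>i\<in>UNIV. 1 + t * M $ i $ i) - 1 - t * (\<Sum>i\<in>UNIV. M $ i $ i)\<bar>
        + \<bar>\<Sum>p\<in>Q. of_int (sign p) * (\<Prod>i\<in>UNIV. A $ i $ p i)\<bar>"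
      by (simp add: trace_def)
    also have "\<dots> \<le> C * t\<^sup>2 + card Q * ((1 + K) ^ CARD('n) * t\<^sup>2)"
      using M t off by (intro add_mono bd order_trans[OF sum_abs] sum_bounded_above) (auto simp: abs_mult sign_def)
    finally show ?thesis by (simp add: A_def algebra_simps)
  qed
  then show ?thesis using C assms
    by (intro exI[of _ "C + card Q * (1 + K) ^ CARD('n)"]) auto
qed

section \<open>Volume of the image under a perturbed identity\<close>

lemma set_integrable_continuous_bounded:
  fixes f :: "'a::euclidean_space \<Rightarrow> real"
  assumes "open A" "bounded A" "continuous_on A f" "\<And>x. x \<in> A \<Longrightarrow> \<bar>f x\<bar> \<le> B"
  shows "set_integrable lborel A f"
  unfolding set_integrable_def
proof (rule integrableI_bounded_set[where A=A and B=B])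
  show "(\<lambda>x. indicator A x *\<^sub>R f x) \<in> borel_measurable lborel"
    using borel_measurable_continuous_on_indicator[OF _ assms(3)] \<open>open A\<close> by simp
  show "emeasure lborel A < \<infinity>" using emeasure_bounded_finite[OF \<open>bounded A\<close>] .
qed (use assms in \<open>auto simp: indicator_def\<close>)

text \<open>
  The determinant expansion, integrated in the change-of-variables formula. Here the index type is
  well-ordered as in that formula; \<open>measure_image_perturbed_identity\<close> passes to any finite index type.
\<close>

lemma measure_image_perturbed_identity_wellorder:
  fixes k :: "real^'n::{finite,wellorder} \<Rightarrow> real^'n::_" and J :: "real^'n::_ \<Rightarrow> real^'n::_^'n::_"
  assumes deriv: "\<And>x. (k has_derivative (*v) (J x)) (at x)"
    and contJ: "continuous_on UNIV J" and bound: "\<And>x i j. \<bar>J x $ i $ j\<bar> \<le> K"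
    and A: "open A" "bounded A"
  shows "\<exists>C. \<forall>t. 0 \<le> t \<longrightarrow> t \<le> 1 \<longrightarrow> inj_on (\<lambda>x. x + t *\<^sub>R k x) A \<longrightarrow>
           measure lebesgue A + t * integral A (\<lambda>x. trace (J x)) - C * t\<^sup>2
             \<le> measure lebesgue ((\<lambda>x. x + t *\<^sub>R k x) ` A)"
proof -
  have "0 \<le> K" using bound by (meson abs_ge_zero order_trans)
  from det_identity_plus_linearization[OF this]
  obtain C where C: "C \<ge> 0" and det: "\<And>(M :: real^'n::_^'n::_) t. (\<forall>i j. \<bar>M $ i $ j\<bar> \<le> K) \<Longrightarrow> 0 \<le> t \<Longrightarrow> t \<le> 1 \<Longrightarrow>
           \<bar>det (mat 1 + t *\<^sub>R M) - 1 - t * trace M\<bar> \<le> C * t\<^sup>2"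
    by blast
  have contJij: "continuous_on S (\<lambda>x. J x $ i $ j)" for S i j
    by (intro continuous_intros continuous_on_subset[OF contJ]) auto
  have tr: "\<bar>trace (J x)\<bar> \<le> CARD('n) * K" for x
    unfolding trace_def by (rule order_trans[OF sum_abs sum_bounded_above]) (use bound in auto)
  have Am: "A \<in> lmeasurable" using A by (simp add: lmeasurable_open)
  have itr: "(\<lambda>x. trace (J x)) integrable_on A"
    by (rule set_borel_integral_eq_integral(1), rule set_integrable_continuous_bounded[OF A _ tr])
       (auto simp: trace_def intro!: continuous_intros contJij)
  have i1: "(\<lambda>x. c::real) integrable_on A" for c using Am by (rule integrable_on_const)
  have "measure lebesgue A + t * integral A (\<lambda>x. trace (J x)) - C * measure lebesgue A * t\<^sup>2
             \<le> measure lebesgue ((\<lambda>x. x + t *\<^sub>R k x) ` A)"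
    if t: "0 \<le> t" "t \<le> 1" and inj: "inj_on (\<lambda>x. x + t *\<^sub>R k x) A" for t :: real
  proof -
    define D where "D x = mat 1 + t *\<^sub>R J x" for x
    have Dv: "D x *v v = v + t *\<^sub>R (J x *v v)" for x v
      by (simp add: D_def matrix_vector_mult_add_rdistrib scaleR_matrix_vector_assoc)
    have detD: "1 + t * trace (J x) - C * t\<^sup>2 \<le> \<bar>det (D x)\<bar>" 
               "\<bar>det (D x)\<bar> \<le> 1 + CARD('n) * K + C" for x
    proof -
      have *: "\<bar>det (D x) - 1 - t * trace (J x)\<bar> \<le> C * t\<^sup>2"
        unfolding D_def using bound t by (intro det) auto
      then show "1 + t * trace (J x) - C * t\<^sup>2 \<le> \<bar>det (D x)\<bar>" by linarith
      have "t * \<bar>trace (J x)\<bar> \<le> 1 * (CARD('n) * K)" using tr t by (intro mult_mono) auto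
      then have "\<bar>t * trace (J x)\<bar> \<le> CARD('n) * K" using t by (simp add: abs_mult)
      moreover have "C * t\<^sup>2 \<le> C" using C t by (intro mult_left_le) (auto simp: power_le_one)
      ultimately show "\<bar>det (D x)\<bar> \<le> 1 + CARD('n) * K + C" using * by linarith
    qed
    have idet: "(\<lambda>x. \<bar>det (D x)\<bar>) integrable_on A"
      by (rule set_borel_integral_eq_integral(1),
          rule set_integrable_continuous_bounded[OF A, where B="1 + CARD('n) * K + C"])
         (use detD(2) in \<open>auto simp: det_def D_def intro!: continuous_intros contJij\<close>)
    have ttr: "(\<lambda>x. t * trace (J x)) integrable_on A"
      using integrable_cmul[OF itr, of t] by simp
    have "measure lebesgue ((\<lambda>x. x + t *\<^sub>R k x) ` A) = integral A (\<lambda>x. \<bar>det (matrix ((*v) (D x)))\<bar>)"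
    proof (rule measure_differentiable_image_eq[OF _ _ inj])
      show "((\<lambda>x. x + t *\<^sub>R k x) has_derivative (*v) (D x)) (at x within A)" for x
        using has_derivative_at_withinI[OF deriv] by (auto simp: Dv intro!: derivative_eq_intros)
    qed (use idet A in auto)
    also have "\<dots> \<ge> integral A (\<lambda>x. (1 + t * trace (J x)) - C * t\<^sup>2)"
      using detD(1) idet by (intro integral_le)
        (auto intro!: integrable_diff integrable_add i1 ttr)
    also have "integral A (\<lambda>x. (1 + t * trace (J x)) - C * t\<^sup>2)
        = measure lebesgue A + t * integral A (\<lambda>x. trace (J x)) - C * measure lebesgue A * t\<^sup>2"
    proof -
      have "integral A (\<lambda>x. C * t\<^sup>2) = C * measure lebesgue A * t\<^sup>2"
        unfolding lmeasure_integral[OF Am] using integral_mult_right[of A "C * t\<^sup>2" "\<lambda>_. 1::real"]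
        by (simp only: mult_1_left mult_1_right mult_ac)
      then show ?thesis
        using Am by (simp add: integral_diff[OF integrable_add[OF i1 ttr] i1]
            integral_add[OF i1 ttr] lmeasure_integral integral_mult_right)
    qed
    finally show ?thesis .
  qed
  then show ?thesis by blast
qed

text \<open>
  Serves to transport results about vectors with a well-ordered index type to any finite index type.
\<close>

typedef ('a::finite) ordered_index = "{..<CARD('a)}"
  by (rule exI[of _ 0]) simp

lemma card_ordered_index: "CARD('a::finite ordered_index) = CARD('a)"
  using type_definition.card[OF type_definition_ordered_index] by simp

instance ordered_index :: (finite) finite
  by standard (metis finite_imageI finite_lessThan type_definition.univ type_definition_ordered_index)

instantiation ordered_index :: (finite) wellorder
begin
definition less_eq_ordered_index :: "'a ordered_index \<Rightarrow> 'a ordered_index \<Rightarrow> bool" where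
  "i \<le> j \<longleftrightarrow> Rep_ordered_index i \<le> Rep_ordered_index j"
definition less_ordered_index :: "'a ordered_index \<Rightarrow> 'a ordered_index \<Rightarrow> bool" where
  "i < j \<longleftrightarrow> Rep_ordered_index i < Rep_ordered_index j"
instance
proof
  fix P :: "'a ordered_index \<Rightarrow> bool" and a
  assume step: "\<And>x. (\<And>y. y < x \<Longrightarrow> P y) \<Longrightarrow> P x"
  show "P a"
    by (induction a rule: measure_induct_rule[of Rep_ordered_index])
       (auto intro: step simp: less_ordered_index_def)
qed (auto simp: less_eq_ordered_index_def less_ordered_index_def Rep_ordered_index_inject)
end

definition reindex :: "('d \<Rightarrow> 'n) \<Rightarrow> 'a^'n \<Rightarrow> 'a^'d" where
  "reindex \<tau> x = (\<chi> i. x $ \<tau> i)"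

lemma reindex_nth [simp]: "reindex \<tau> x $ i = x $ \<tau> i"
  by (simp add: reindex_def)

lemma reindex_inv [simp]:
  assumes "bij \<tau>"
  shows "reindex \<tau> (reindex (inv \<tau>) x) = x" "reindex (inv \<tau>) (reindex \<tau> y) = y"
  using assms by (auto simp: vec_eq_iff bij_is_inj bij_is_surj surj_f_inv_f)

lemma linear_reindex: "linear (reindex \<tau> :: real^'n::finite \<Rightarrow> real^'d::finite)"
  by (rule linearI) (auto simp: vec_eq_iff)

lemma prod_Basis_vec:
  fixes f :: "real^'n::finite \<Rightarrow> 'b::comm_monoid_mult"
  shows "(\<Prod>b\<in>Basis. f b) = (\<Prod>i\<in>UNIV. f (axis i 1))"
proof -
  have B: "Basis = range (\<lambda>i. axis i 1 :: real^'n)" by (auto simp: Basis_vec_def)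
  have inj: "inj (\<lambda>i. axis i 1 :: real^'n)" by (auto simp: inj_def axis_eq_axis)
  show ?thesis unfolding B by (subst prod.reindex[OF inj]) (simp add: o_def)
qed

text \<open>
  Permuting coordinates maps boxes to boxes with the same side lengths.
\<close>

lemma lborel_distr_reindex:
  fixes \<tau> :: "'d::finite \<Rightarrow> 'n::finite"
  assumes \<tau>: "bij \<tau>"
  shows "distr lborel borel (reindex \<tau> :: real^'n \<Rightarrow> real^'d) = lborel"
proof (rule lborel_eqI[symmetric])
  fix l u :: "real^'d" assume lu: "\<And>b. b \<in> Basis \<Longrightarrow> l \<bullet> b \<le> u \<bullet> b"
  let ?l = "reindex (inv \<tau>) l :: real^'n" and ?u = "reindex (inv \<tau>) u :: real^'n"
  have le: "l $ i \<le> u $ i" for i using lu[of "axis i 1"] by (simp add: inner_axis axis_in_Basis_iff)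
  have meas: "(reindex \<tau> :: real^'n \<Rightarrow> real^'d) \<in> borel_measurable lborel"
    by (simp add: borel_measurable_continuous_onI linear_continuous_on linear_reindex linear_conv_bounded_linear[symmetric])
  have all: "(\<forall>i. P (\<tau> i)) \<longleftrightarrow> (\<forall>j. P j)" for P using \<tau> by (metis bij_pointE)
  have "reindex \<tau> -` box l u = box ?l ?u"
    using all[of "\<lambda>j. l $ inv \<tau> j < _ $ j \<and> _ $ j < u $ inv \<tau> j"] \<tau>
    by (auto simp: mem_box_cart bij_is_inj) 
  then have "emeasure (distr lborel borel (reindex \<tau>)) (box l u) = emeasure lborel (box ?l ?u)"
    using meas by (simp add: emeasure_distr)
  also have "\<dots> = ennreal (\<Prod>j\<in>UNIV. u $ inv \<tau> j - l $ inv \<tau> j)"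
  proof -
    have "?l \<bullet> b \<le> ?u \<bullet> b" if "b \<in> Basis" for b
      using le that by (auto simp: Basis_vec_def inner_axis)
    then show ?thesis by (simp add: prod_Basis_vec inner_axis)
  qed
  also have "(\<Prod>j\<in>UNIV. u $ inv \<tau> j - l $ inv \<tau> j) = (\<Prod>i\<in>UNIV. u $ i - l $ i)"
    by (rule prod.reindex_bij_betw[OF bij_imp_bij_inv[OF \<tau>]])
  finally show "emeasure (distr lborel borel (reindex \<tau>)) (box l u) = (\<Prod>b\<in>Basis. (u - l) \<bullet> b)"
    by (simp add: prod_Basis_vec inner_axis)
qed simp


lemma measure_vimage_reindex:
  fixes \<tau> :: "'d::finite \<Rightarrow> 'n::finite" and U :: "(real^'d) set"
  assumes \<tau>: "bij \<tau>" and "open U"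
  shows "open (reindex \<tau> -` U)"
    and "measure lebesgue (reindex \<tau> -` U) = measure lebesgue U"
proof -
  have cont: "continuous_on UNIV (reindex \<tau> :: real^'n \<Rightarrow> real^'d)"
    by (simp add: linear_continuous_on linear_reindex linear_conv_bounded_linear[symmetric])
  show op: "open (reindex \<tau> -` U)" using cont \<open>open U\<close> by (simp add: open_vimage)
  have "measure lebesgue U = measure (distr lborel borel (reindex \<tau> :: real^'n \<Rightarrow> real^'d)) U"
    using \<open>open U\<close> by (simp add: lborel_distr_reindex[OF \<tau>] measure_completion)
  also have "\<dots> = measure lborel (reindex \<tau> -` U)"
    using cont \<open>open U\<close> by (subst measure_distr) (auto simp: borel_measurable_continuous_onI)
  finally show "measure lebesgue (reindex \<tau> -` U) = measure lebesgue U"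
    using op by (simp add: measure_completion)
qed

lemma integral_vimage_reindex:
  fixes \<tau> :: "'d::finite \<Rightarrow> 'n::finite" and f :: "real^'d \<Rightarrow> real"
  assumes \<tau>: "bij \<tau>" and U: "open U" "bounded U" 
    and f: "continuous_on UNIV f" "\<And>x. \<bar>f x\<bar> \<le> B"
  shows "integral (reindex \<tau> -` U) (\<lambda>x. f (reindex \<tau> x)) = integral U f"
proof -
  have cont: "continuous_on UNIV (reindex \<tau> :: real^'n \<Rightarrow> real^'d)"
    by (simp add: linear_continuous_on linear_reindex linear_conv_bounded_linear[symmetric])
  have op: "open (reindex \<tau> -` U)" using cont \<open>open U\<close> by (simp add: open_vimage)
  have "bounded (reindex (inv \<tau>) ` U)"
    using U(2) by (simp add: bounded_linear_image linear_reindex linear_conv_bounded_linear[symmetric])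
  moreover have "reindex \<tau> -` U \<subseteq> reindex (inv \<tau>) ` U"
    using reindex_inv(2)[OF \<tau>] by (metis (no_types, lifting) image_eqI subsetI vimage_eq)
  ultimately have bd: "bounded (reindex \<tau> -` U)" by (rule bounded_subset)
  have fU: "set_integrable lborel U f"
    using set_integrable_continuous_bounded[OF U continuous_on_subset[OF f(1)] f(2)] by simp
  have fV: "set_integrable lborel (reindex \<tau> -` U) (\<lambda>x. f (reindex \<tau> x))"
    by (rule set_integrable_continuous_bounded[OF op bd _ f(2)])
       (intro continuous_on_compose2[OF f(1) continuous_on_subset[OF cont]], auto)
  have "integral U f = (LINT x|distr lborel borel (reindex \<tau> :: real^'n \<Rightarrow> real^'d). indicator U x *\<^sub>R f x)"
    using set_borel_integral_eq_integral(2)[OF fU] 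
    by (simp add: set_lebesgue_integral_def lborel_distr_reindex[OF \<tau>])
  also have "\<dots> = (LINT x|lborel. indicator U (reindex \<tau> x) *\<^sub>R f (reindex \<tau> x))"
    using fU cont lborel_distr_reindex[OF \<tau>] unfolding set_integrable_def
    by (intro integral_distr) (auto simp: borel_measurable_continuous_onI dest!: borel_measurable_integrable)
  also have "\<dots> = integral (reindex \<tau> -` U) (\<lambda>x. f (reindex \<tau> x))"
    using set_borel_integral_eq_integral(2)[OF fV] 
    by (simp add: set_lebesgue_integral_def indicator_vimage)
  finally show ?thesis by simp
qed

text \<open>
  The well-ordered case transported by the reindexing isometry \<open>Q\<close>: conjugating \<open>k\<close> by \<open>Q\<close> permutes rows and
  columns of the Jacobian simultaneously, which preserves its trace, and \<open>Q\<close> preserves volume.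
\<close>

lemma measure_image_perturbed_identity:
  fixes k :: "real^'d::finite \<Rightarrow> real^'d" and J :: "real^'d \<Rightarrow> real^'d^'d"
  assumes deriv: "\<And>x. (k has_derivative (*v) (J x)) (at x)"
    and contJ: "continuous_on UNIV J" and bound: "\<And>x i j. \<bar>J x $ i $ j\<bar> \<le> K"
    and A: "open A" "bounded A"
  shows "\<exists>C. \<forall>t. 0 \<le> t \<longrightarrow> t \<le> 1 \<longrightarrow> inj_on (\<lambda>x. x + t *\<^sub>R k x) A \<longrightarrow>
           measure lebesgue A + t * integral A (\<lambda>x. trace (J x)) - C * t\<^sup>2
             \<le> measure lebesgue ((\<lambda>x. x + t *\<^sub>R k x) ` A)"
proof -
  obtain \<tau> :: "'d \<Rightarrow> 'd ordered_index" where \<tau>: "bij \<tau>"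
    using finite_same_card_bij[of "UNIV :: 'd set" "UNIV :: 'd ordered_index set"]
    by (auto simp: card_ordered_index)
  define Q where "Q = (reindex \<tau> :: real^('d ordered_index) \<Rightarrow> real^'d)"
  define P where "P = (reindex (inv \<tau>) :: real^'d \<Rightarrow> real^('d ordered_index))"
  have QP [simp]: "Q (P x) = x" and PQ [simp]: "P (Q y) = y" for x y
    by (simp_all add: P_def Q_def reindex_inv[OF \<tau>])
  have lin: "linear P" "linear Q" by (simp_all add: P_def Q_def linear_reindex)
  have blin: "bounded_linear P" "bounded_linear Q" using lin by (simp_all add: linear_conv_bounded_linear)
  define k' where "k' y = P (k (Q y))" for y
  define J' where "J' y = (\<chi> i j. J (Q y) $ inv \<tau> i $ inv \<tau> j)" for y
  have J'v: "J' y *v v = P (J (Q y) *v Q v)" for y v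
  proof (intro vec_eq_iff[THEN iffD2] allI)
    fix i
    have "(\<Sum>j\<in>UNIV. J (Q y) $ inv \<tau> i $ inv \<tau> j * v $ j) 
        = (\<Sum>j\<in>UNIV. J (Q y) $ inv \<tau> i $ inv \<tau> (\<tau> j) * v $ \<tau> j)"
      by (rule sum.reindex_bij_betw[OF \<tau>, symmetric])
    then show "(J' y *v v) $ i = P (J (Q y) *v Q v) $ i"
      using \<tau> by (simp add: J'_def P_def Q_def matrix_vector_mult_def bij_is_inj)
  qed
  have tr: "trace (J' y) = trace (J (Q y))" for y
    unfolding trace_def J'_def
    using sum.reindex_bij_betw[OF bij_imp_bij_inv[OF \<tau>], of "\<lambda>i. J (Q y) $ i $ i"] by simp
  have contQ: "continuous_on S Q" for S using blin(2) linear_continuous_on by blast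
  have deriv': "(k' has_derivative (*v) (J' y)) (at y)" for y
  proof -
    have "((\<lambda>y. P (k (Q y))) has_derivative (\<lambda>v. P (J (Q y) *v Q v))) (at y)"
      by (intro bounded_linear.has_derivative[OF blin(1)] has_derivative_compose[OF _ deriv]
          bounded_linear_imp_has_derivative blin(2))
    moreover have "(*v) (J' y) = (\<lambda>v. P (J (Q y) *v Q v))" by (rule ext) (rule J'v)
    ultimately show ?thesis by (simp add: k'_def[abs_def])
  qed
  have contJ': "continuous_on UNIV J'"
    unfolding J'_def
    by (intro continuous_intros continuous_on_compose2[OF contJ contQ]) auto
  have bound': "\<bar>J' y $ i $ j\<bar> \<le> K" for y i j by (simp add: J'_def bound)
  have vimQ: "Q -` S = P ` S" for S by (force intro: image_eqI[of _ P "Q _"])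
  have A': "open (Q -` A)" "measure lebesgue (Q -` A) = measure lebesgue A"
    unfolding Q_def using measure_vimage_reindex[OF \<tau> A(1)] by auto
  have "bounded (Q -` A)" unfolding vimQ using A(2) blin(1) bounded_linear_image by blast
  from measure_image_perturbed_identity_wellorder[OF deriv' contJ' bound' A'(1) this]
  obtain C where C: "\<And>t. 0 \<le> t \<Longrightarrow> t \<le> 1 \<Longrightarrow> inj_on (\<lambda>x. x + t *\<^sub>R k' x) (Q -` A) \<Longrightarrow>
           measure lebesgue (Q -` A) + t * integral (Q -` A) (\<lambda>x. trace (J' x)) - C * t\<^sup>2
             \<le> measure lebesgue ((\<lambda>x. x + t *\<^sub>R k' x) ` (Q -` A))" by blast
  have trJ: "\<bar>trace (J x)\<bar> \<le> CARD('d) * K" for x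
    unfolding trace_def by (rule order_trans[OF sum_abs sum_bounded_above]) (use bound in auto)
  have contJij: "continuous_on S (\<lambda>x. J x $ i $ j)" for S i j
    by (intro continuous_intros continuous_on_subset[OF contJ]) auto
  have int: "integral (Q -` A) (\<lambda>x. trace (J' x)) = integral A (\<lambda>x. trace (J x))"
    unfolding tr Q_def
    by (rule integral_vimage_reindex[OF \<tau> A _ trJ]) (auto simp: trace_def intro!: continuous_intros contJij)
  have contk: "continuous_on S k" for S
    by (rule has_derivative_continuous_on) (rule has_derivative_at_withinI[OF deriv])
  have "measure lebesgue A + t * integral A (\<lambda>x. trace (J x)) - C * t\<^sup>2
             \<le> measure lebesgue ((\<lambda>x. x + t *\<^sub>R k x) ` A)"
    if t: "0 \<le> t" "t \<le> 1" and inj: "inj_on (\<lambda>x. x + t *\<^sub>R k x) A" for t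
  proof -
    have conj: "y + t *\<^sub>R k' y = P (Q y + t *\<^sub>R k (Q y))" for y
      by (simp add: k'_def linear_add[OF lin(1)] linear_cmul[OF lin(1)])
    have inj': "inj_on (\<lambda>x. x + t *\<^sub>R k' x) (Q -` A)"
    proof (rule inj_onI)
      fix y z assume yz: "y \<in> Q -` A" "z \<in> Q -` A" and eq: "y + t *\<^sub>R k' y = z + t *\<^sub>R k' z"
      have "Q (P (Q y + t *\<^sub>R k (Q y))) = Q (P (Q z + t *\<^sub>R k (Q z)))"
        using eq by (simp only: conj)
      then have "Q y + t *\<^sub>R k (Q y) = Q z + t *\<^sub>R k (Q z)" by (simp only: QP)
      then have "Q y = Q z" by (rule inj_onD[OF inj]) (use yz in auto)
      then have "P (Q y) = P (Q z)" by (simp only:)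
      then show "y = z" by (simp only: PQ)
    qed
    have im: "(\<lambda>x. x + t *\<^sub>R k' x) ` (Q -` A) = Q -` ((\<lambda>x. x + t *\<^sub>R k x) ` A)"
      unfolding conj vimQ image_image QP ..
    have "open ((\<lambda>x. x + t *\<^sub>R k x) ` A)"
      by (rule invariance_of_domain[OF _ A(1) inj]) (intro continuous_intros contk)
    then have "measure lebesgue (Q -` ((\<lambda>x. x + t *\<^sub>R k x) ` A)) = measure lebesgue ((\<lambda>x. x + t *\<^sub>R k x) ` A)"
      unfolding Q_def by (rule measure_vimage_reindex(2)[OF \<tau>])
    then show ?thesis using C[OF t inj'] unfolding im A'(2) int by simp
  qed
  then show ?thesis by blast
qed

section \<open>Divergence over flow-invariant open sets\<close>

text \<open>
  Of two points at distance below \<open>1\<close>, either both lie in a compact ball slightly larger than the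
  support, or both lie where the function vanishes.
\<close>

lemma compact_support_uniformly_continuous:
  fixes f :: "'a::euclidean_space \<Rightarrow> 'b::real_normed_vector"
  assumes cont: "continuous_on UNIV f" and "compact S" and zero: "\<And>x. x \<notin> S \<Longrightarrow> f x = 0"
  shows "uniformly_continuous_on UNIV f"
proof (unfold uniformly_continuous_on_def, intro allI impI)
  fix e :: real assume "e > 0"
  obtain r where r: "S \<subseteq> cball 0 r" 
    using compact_imp_bounded[OF \<open>compact S\<close>] unfolding bounded_iff by (auto simp: subset_iff)
  have "uniformly_continuous_on (cball 0 (r + 1)) f"
    by (rule compact_uniformly_continuous[OF continuous_on_subset[OF cont]]) auto
  then obtain d where d: "d > 0" and unif: "\<And>x x'. x \<in> cball 0 (r + 1) \<Longrightarrow> x' \<in> cball 0 (r + 1) \<Longrightarrow> dist x' x < d \<Longrightarrow> dist (f x') (f x) < e"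
    unfolding uniformly_continuous_on_def using \<open>e > 0\<close> by metis
  have "dist (f x') (f x) < e" if "dist x' x < min d 1" for x x'
  proof (cases "x \<in> cball 0 (r + 1) \<and> x' \<in> cball 0 (r + 1)")
    case True
    then show ?thesis using unif that by auto
  next
    case False
    then have "x \<notin> cball 0 r" "x' \<notin> cball 0 r"
      using that norm_triangle_ineq2[of x x'] norm_triangle_ineq2[of x' x]
      by (auto simp: dist_norm norm_minus_commute)
    then show ?thesis using zero r \<open>e > 0\<close> by (metis dist_self subsetD)
  qed
  then show "\<exists>d>0. \<forall>x\<in>UNIV. \<forall>x'\<in>UNIV. dist x' x < d \<longrightarrow> dist (f x') (f x) < e"
    using d by (intro exI[of _ "min d 1"]) auto
qed

lemma norm_matrix_vector_le:
  fixes M :: "real^'n::finite^'m::finite"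
  assumes "\<And>i j. \<bar>M $ i $ j\<bar> \<le> B"
  shows "norm (M *v v) \<le> (real CARD('m) * real CARD('n) * B) * norm v"
  using onorm[OF matrix_vector_mul_bounded_linear, of M v]
    mult_right_mono[OF onorm_le_matrix_component[OF assms], of "norm v"] by simp

lemma one_plus_power_le:
  assumes "0 \<le> (y::real)" "y \<le> 1"
  shows "(1 + y) ^ n \<le> 1 + (2 ^ n - 1) * y"
proof (induction n)
  case (Suc n)
  have "(1 + y) ^ Suc n \<le> (1 + y) * (1 + (2 ^ n - 1) * y)" using Suc assms by (simp add: mult_left_mono)
  also have "\<dots> = 1 + 2 ^ n * y + ((2 ^ n - 1) * y) * y" by (simp add: algebra_simps)
  also have "((2 ^ n - 1) * y) * y \<le> (2 ^ n - 1) * y"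
    using assms by (intro mult_left_le) auto
  finally show ?case by (simp add: algebra_simps)
qed simp

text \<open>
  Applied with \<open>f\<close> a time-one map and \<open>g\<close> its first-order approximation: \<open>g\<close> factors through \<open>f\<close> by an
  \<open>L\<close>-Lipschitz map defined on \<open>f ` A \<subseteq> A\<close>.
\<close>

lemma measure_image_le_of_lipschitz_inverse:
  fixes f g :: "'a::euclidean_space \<Rightarrow> 'a"
  assumes A: "open A" "bounded A" and f: "open (f ` A)" "f ` A \<subseteq> A" and g: "open (g ` A)"
    and "0 \<le> L" and gf: "\<And>x y. x \<in> A \<Longrightarrow> y \<in> A \<Longrightarrow> norm (g x - g y) \<le> L * norm (f x - f y)"
  shows "measure lebesgue (g ` A) \<le> L ^ DIM('a) * measure lebesgue A"
proof -
  define h where "h = (\<lambda>y. g (inv_into A f y))"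
  have sel: "inv_into A f y \<in> A" "f (inv_into A f y) = y" if "y \<in> f ` A" for y
    using that by (auto simp: inv_into_into f_inv_into_f)
  have hf: "h (f x) = g x" if "x \<in> A" for x
    using gf[of "inv_into A f (f x)" x] sel[of "f x"] that by (simp add: h_def)
  have lip: "L-lipschitz_on (f ` A) h"
    using gf hf \<open>0 \<le> L\<close> by (intro lipschitz_onI) (auto simp: dist_norm)
  have im: "h ` f ` A = g ` A" using hf by (auto simp: image_image)
  have Am: "A \<in> lmeasurable" using A by (simp add: lmeasurable_open)
  have "emeasure lebesgue (g ` A) \<le> ennreal (L ^ DIM('a)) * emeasure lebesgue (f ` A)"
    using lipschitz_image_measure_le[OF refl lip f(1)] g unfolding im by simp
  also have "\<dots> \<le> ennreal (L ^ DIM('a)) * emeasure lebesgue A"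
    using f A by (intro mult_left_mono emeasure_mono) auto
  also have "\<dots> = ennreal (L ^ DIM('a) * measure lebesgue A)"
    using Am \<open>0 \<le> L\<close> by (simp add: emeasure_eq_measure2 ennreal_mult')
  finally show ?thesis
    unfolding measure_def[of lebesgue "g ` A"] using \<open>0 \<le> L\<close> by (intro enn2real_leI) auto
qed

text \<open>
  Here \<open>trace (J x)\<close> is the divergence of \<open>k\<close> at \<open>x\<close>. Volume can only be lost when \<open>A\<close> is mapped into
  itself, so the integrated divergence, which is the rate of change of the volume, is not positive. The rate is
  computed from the image of \<open>A\<close> under \<open>x \<mapsto> x + t k(x)\<close>, which has explicit volume and agrees with
  the time-one map to first order.
\<close>

lemma integral_divergence_nonpos:
  fixes k :: "real^'d::finite \<Rightarrow> real^'d" and J :: "real^'d \<Rightarrow> real^'d^'d"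
  assumes deriv: "\<And>x. (k has_derivative (*v) (J x)) (at x)"
    and contJ: "continuous_on UNIV J" and "compact S"
    and supp: "\<And>x. x \<notin> S \<Longrightarrow> k x = 0" "\<And>x. x \<notin> S \<Longrightarrow> J x = 0"
    and A: "open A" "bounded A"
    and inv: "\<And>t. 0 < t \<Longrightarrow> (1/2)-lipschitz_on UNIV (\<lambda>x. t *\<^sub>R k x) \<Longrightarrow> time_one_map (\<lambda>x. t *\<^sub>R k x) ` A \<subseteq> A"
  shows "integral A (\<lambda>x. trace (J x)) \<le> 0"
proof -
  have contk: "continuous_on T k" for T
    by (rule has_derivative_continuous_on) (rule has_derivative_at_withinI[OF deriv])
  have "bounded (J ` S)" "bounded (k ` S)"
    by (auto intro!: compact_imp_bounded compact_continuous_image continuous_on_subset[OF contJ] contk \<open>compact S\<close>)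
  then obtain KJ Kk where KJ: "KJ > 0" "\<And>x. x \<in> S \<Longrightarrow> norm (J x) \<le> KJ" 
      and Kk: "Kk > 0" "\<And>x. x \<in> S \<Longrightarrow> norm (k x) \<le> Kk"
    unfolding bounded_pos by (auto simp: image_iff)
  have entry: "\<bar>M $ i $ j\<bar> \<le> norm M" for M :: "real^'d^'d" and i j
    using Finite_Cartesian_Product.norm_nth_le[of M i] Finite_Cartesian_Product.norm_nth_le[of "M $ i" j] by simp
  have J_le: "\<bar>J x $ i $ j\<bar> \<le> KJ" for x i j
    using entry[of "J x" i j] KJ supp(2)[of x] by (cases "x \<in> S") (auto intro: order_trans)
  define n where "n = real CARD('d) * real CARD('d)"
  have n: "n > 0" by (simp add: n_def)
  define K where "K = n * KJ + Kk"
  have bound: "norm (J x *v v) \<le> K * norm v" for x v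
    using norm_matrix_vector_le[of "J x" KJ v] J_le mult_right_mono[of "n * KJ" K "norm v"] Kk
    by (simp add: K_def n_def)
  have k_le: "norm (k x) \<le> K" for x
    using Kk(2)[of x] supp(1)[of x] Kk(1) KJ(1) n by (cases "x \<in> S") (auto simp: K_def intro: order_trans)
  obtain C where C: "\<And>t. 0 \<le> t \<Longrightarrow> t \<le> 1 \<Longrightarrow> inj_on (\<lambda>x. x + t *\<^sub>R k x) A \<Longrightarrow>
           measure lebesgue A + t * integral A (\<lambda>x. trace (J x)) - C * t\<^sup>2
             \<le> measure lebesgue ((\<lambda>x. x + t *\<^sub>R k x) ` A)"
    using measure_image_perturbed_identity[OF deriv contJ J_le A] by blast
  define I where "I = integral A (\<lambda>x. trace (J x))"
  define m where "m = measure lebesgue A"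
  define N where "N = (2::real) ^ CARD('d) - 1"
  have "0 \<le> N" "0 \<le> m" by (auto simp: N_def m_def)
  have kL: "norm (k x - k x') \<le> K * norm (x - x')" for x x'
    by (rule differentiable_bound[of UNIV k "\<lambda>x. (*v) (J x)"]) (use deriv bound in \<open>auto intro!: onorm_le\<close>)
  \<comment> \<open>A relative error \<open>\<epsilon>\<close> in the first-order approximation costs a multiple of \<open>\<epsilon>\<close>, which then tends to zero.\<close>
  have approx: "I \<le> N * (2 * \<epsilon>) * m" if "\<epsilon> > 0" for \<epsilon>
  proof -
    have "uniformly_continuous_on UNIV J"
      using compact_support_uniformly_continuous[OF contJ \<open>compact S\<close> supp(2)] .
    moreover have "\<epsilon> / n > 0" using that n by simp
    ultimately obtain \<delta> where \<delta>: "\<delta> > 0" and unifJ: "\<And>x x'. norm (x - x') < \<delta> \<Longrightarrow> norm (J x - J x') < \<epsilon> / n"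
      unfolding uniformly_continuous_on_def dist_norm by blast
    have unif: "norm (J x *v v - J x' *v v) \<le> \<epsilon> * norm v" if "norm (x - x') < \<delta>" for x x' v
    proof -
      have "\<bar>(J x - J x') $ i $ j\<bar> \<le> \<epsilon> / n" for i j
        using entry[of "J x - J x'" i j] unifJ[OF that] by linarith
      from norm_matrix_vector_le[OF this, of v] n show ?thesis
        by (simp add: n_def matrix_vector_mult_diff_rdistrib)
    qed
    \<comment> \<open>The two volume estimates for small positive \<open>t\<close>, divided by \<open>t\<close>.\<close>
    have step: "I \<le> C * t + N * (2 * (\<epsilon> + 2 * t * K\<^sup>2)) * m"
      if t: "0 < t" "t \<le> 1" "t * K < 1/2" "t * K < \<delta>" "2 * t * (\<epsilon> + 2 * t * K\<^sup>2) < 1" for t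
    proof -
      define \<eta> where "\<eta> = t * (\<epsilon> + 2 * t * K\<^sup>2)"
      have \<eta>: "0 \<le> \<eta>" "2 * \<eta> \<le> 1" using t \<open>\<epsilon> > 0\<close> by (auto simp: \<eta>_def)
      let ?\<Psi> = "time_one_map (\<lambda>x. t *\<^sub>R k x)" and ?T = "\<lambda>x. x + t *\<^sub>R k x"
      have lip: "(1/2)-lipschitz_on UNIV (\<lambda>x. t *\<^sub>R k x)"
      proof (intro lipschitz_onI)
        fix x x'
        have "t * norm (k x - k x') \<le> t * (K * norm (x - x'))" using kL t by (intro mult_left_mono) auto
        also have "\<dots> \<le> 1/2 * norm (x - x')" 
          using mult_right_mono[of "t * K" "1/2" "norm (x - x')"] t by (simp add: mult_ac)
        finally show "dist (t *\<^sub>R k x) (t *\<^sub>R k x') \<le> 1/2 * dist x x'"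
          using t by (simp add: dist_norm scaleR_diff_right[symmetric])
      qed simp
      have expand: "norm (x - y) \<le> 2 * norm (?\<Psi> x - ?\<Psi> y)" for x y
        using time_one_map_lipschitz(2)[OF lip, of x y] by simp
      have TPsi: "norm (?T x - ?T y) \<le> (1 + 2 * \<eta>) * norm (?\<Psi> x - ?\<Psi> y)" for x y
      proof -
        have "norm ((?\<Psi> x - ?T x) - (?\<Psi> y - ?T y)) \<le> \<eta> * norm (x - y)"
          unfolding \<eta>_def
          by (rule time_one_map_linearization[OF deriv bound k_le unif]) (use t in auto)
        also have "\<dots> \<le> \<eta> * (2 * norm (?\<Psi> x - ?\<Psi> y))" using expand \<eta> by (intro mult_left_mono)
        finally have "norm ((?\<Psi> x - ?\<Psi> y) - (?T x - ?T y)) \<le> \<eta> * (2 * norm (?\<Psi> x - ?\<Psi> y))"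
          by (simp add: algebra_simps)
        then show ?thesis
          using norm_triangle_ineq3[of "?T x - ?T y" "?\<Psi> x - ?\<Psi> y"]
          by (simp add: algebra_simps norm_minus_commute)
      qed
      have inj: "inj_on ?T A"
      proof (rule inj_onI)
        fix x y assume eq: "?T x = ?T y"
        have "x - y = ?T x - (y + t *\<^sub>R k x)" by simp
        also have "\<dots> = t *\<^sub>R k y - t *\<^sub>R k x" unfolding eq by simp
        finally have "norm (x - y) \<le> 1/2 * norm (y - x)"
          using lipschitz_onD[OF lip, of y x] by (simp add: dist_norm)
        then show "x = y" by (simp add: norm_minus_commute)
      qed
      have op: "open (?T ` A)"
        by (rule invariance_of_domain[OF _ A(1) inj]) (intro continuous_intros contk)
      have "m + t * I - C * t\<^sup>2 \<le> measure lebesgue (?T ` A)"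
        unfolding m_def I_def using C[OF _ _ inj] t by auto
      also have "\<dots> \<le> (1 + 2 * \<eta>) ^ CARD('d) * m"
        using measure_image_le_of_lipschitz_inverse[OF A open_image_time_one_map[OF lip _ A(1)] inv[OF t(1) lip] op _ TPsi]
          \<eta> by (simp add: m_def)
      also have "\<dots> \<le> (1 + N * (2 * \<eta>)) * m"
        unfolding N_def using \<eta> one_plus_power_le[of "2 * \<eta>"] \<open>0 \<le> m\<close> by (intro mult_right_mono) auto
      finally have "t * I \<le> t * (C * t + N * (2 * (\<epsilon> + 2 * t * K\<^sup>2)) * m)"
        by (simp add: \<eta>_def algebra_simps power2_eq_square)
      then show ?thesis using t(1) by simp
    qed
    have "\<forall>\<^sub>F t in at_right 0. I \<le> C * t + N * (2 * (\<epsilon> + 2 * t * K\<^sup>2)) * m"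
    proof -
      have "\<forall>\<^sub>F t in at_right 0. t * K < 1/2" "\<forall>\<^sub>F t in at_right 0. t * K < \<delta>" 
        "\<forall>\<^sub>F t in at_right 0. 2 * t * (\<epsilon> + 2 * t * K\<^sup>2) < 1"
        by (rule order_tendstoD(2)[where y=0]; use \<delta> in \<open>auto intro!: tendsto_eq_intros\<close>)+
      moreover have "\<forall>\<^sub>F t in at_right (0::real). t < 1" by (rule eventually_at_rightI[of 0 1]) auto
      ultimately show ?thesis using eventually_at_right_less[of 0]
        by eventually_elim (rule step; simp)
    qed
    moreover have "((\<lambda>t. C * t + N * (2 * (\<epsilon> + 2 * t * K\<^sup>2)) * m) \<longlongrightarrow> N * (2 * \<epsilon>) * m) (at_right 0)"
      by (auto intro!: tendsto_eq_intros)
    ultimately show ?thesis by (intro tendsto_lowerbound) auto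
  qed
  have "((\<lambda>\<epsilon>. N * (2 * \<epsilon>) * m) \<longlongrightarrow> 0) (at_right 0)" by (auto intro!: tendsto_eq_intros)
  moreover have "\<forall>\<^sub>F \<epsilon> in at_right 0. I \<le> N * (2 * \<epsilon>) * m"
    using eventually_at_right_less[of 0] by eventually_elim (rule approx)
  ultimately show ?thesis unfolding I_def by (intro tendsto_lowerbound) auto
qed

section \<open>Lipschitz trajectories\<close>

text \<open>
  The trajectories built below are concatenations of \<open>C\<^sup>1\<close> pieces with continuous controls. This
  class is closed under concatenation for simple reasons: corners go into the exceptional set \<open>F\<close>,
  and the control and velocity are total functions, so that measurability is a statement about the real line.
\<close>

definition lipschitz_trajectory ::
  "(real^'d::finite) set \<Rightarrow> ('m::finite \<Rightarrow> real^'d \<Rightarrow> real^'d) \<Rightarrow> (real \<Rightarrow> real^'d) \<Rightarrow> bool" where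
  "lipschitz_trajectory \<Omega> g \<gamma> \<longleftrightarrow>
     (\<exists>L. L-lipschitz_on {0..1} \<gamma>) \<and> (\<forall>t\<in>{0..1}. \<gamma> t \<in> \<Omega>) \<and>
     (\<exists>v (u :: real \<Rightarrow> real^'m) F B. finite F \<and> v \<in> borel_measurable borel \<and> u \<in> borel_measurable borel \<and>
        (\<forall>t. norm (v t) \<le> B \<and> norm (u t) \<le> B) \<and>
        (\<forall>t\<in>{0<..<1} - F. (\<gamma> has_vector_derivative v t) (at t) \<and> v t = (\<Sum>i\<in>UNIV. u t $ i *\<^sub>R g i (\<gamma> t))))"

lemma lipschitz_trajectoryI:
  fixes g :: "'m::finite \<Rightarrow> real^'d::finite \<Rightarrow> real^'d"
  assumes "L-lipschitz_on {0..1} \<gamma>" "\<And>t. t \<in> {0..1} \<Longrightarrow> \<gamma> t \<in> \<Omega>" "finite F"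
    and "v \<in> borel_measurable borel" "u \<in> borel_measurable borel"
    and "\<And>t. norm (v t) \<le> B" "\<And>t. norm (u t :: real^'m) \<le> B"
    and "\<And>t. t \<in> {0<..<1} - F \<Longrightarrow>
      (\<gamma> has_vector_derivative v t) (at t) \<and> v t = (\<Sum>i\<in>UNIV. u t $ i *\<^sub>R g i (\<gamma> t))"
  shows "lipschitz_trajectory \<Omega> g \<gamma>"
  unfolding lipschitz_trajectory_def
  by (intro conjI exI[of _ L] exI[of _ v] exI[of _ u] exI[of _ F] exI[of _ B] ballI allI assms)

lemma lipschitz_imp_absolutely_continuous:
  assumes lip: "L-lipschitz_on {a..b} \<gamma>"
  shows "absolutely_continuous_on a b \<gamma>"
  unfolding absolutely_continuous_on_def
proof (intro allI impI)
  fix \<epsilon> :: real assume "\<epsilon> > 0"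
  have L0: "0 \<le> L" using lip lipschitz_on_nonneg by blast
  have "(\<Sum>K\<in>D. norm (\<gamma> (Sup K) - \<gamma> (Inf K))) < \<epsilon>"
    if D: "D division_of \<Union>D" "\<Union>D \<subseteq> {a..b}" and small: "(\<Sum>K\<in>D. Sup K - Inf K) < \<epsilon> / (L + 1)" for D
  proof -
    have len: "norm (\<gamma> (Sup K) - \<gamma> (Inf K)) \<le> (L + 1) * (Sup K - Inf K)" if KD: "K \<in> D" for K
    proof -
      obtain c d where K: "K = cbox c d" using division_ofD(4)[OF D(1) KD] by blast
      moreover have "K \<noteq> {}" "K \<subseteq> {a..b}" using division_ofD(3)[OF D(1) KD] D(2) KD by auto
      ultimately have cd: "c \<le> d" "c \<in> {a..b}" "d \<in> {a..b}" and "Sup K = d" "Inf K = c"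
        by (auto simp: cbox_interval)
      moreover have "norm (\<gamma> d - \<gamma> c) \<le> L * (d - c)"
        using lipschitz_onD[OF lip cd(3) cd(2)] cd(1) by (simp add: dist_norm)
      ultimately show ?thesis by (simp add: algebra_simps)
    qed
    have "(\<Sum>K\<in>D. norm (\<gamma> (Sup K) - \<gamma> (Inf K))) \<le> (L + 1) * (\<Sum>K\<in>D. Sup K - Inf K)"
      unfolding sum_distrib_left using len by (rule sum_mono)
    also have "\<dots> < \<epsilon>" using small L0 by (simp add: field_simps)
    finally show ?thesis .
  qed
  then show "\<exists>\<delta>>0. \<forall>D. D division_of \<Union>D \<and> \<Union>D \<subseteq> {a..b} \<and> (\<Sum>K\<in>D. Sup K - Inf K) < \<delta> \<longrightarrow>
               (\<Sum>K\<in>D. norm (\<gamma> (Sup K) - \<gamma> (Inf K))) < \<epsilon>"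
    using L0 \<open>\<epsilon> > 0\<close> by (intro exI[of _ "\<epsilon> / (L + 1)"]) auto
qed

lemma bounded_borel_in_L2:
  fixes f :: "'a::euclidean_space \<Rightarrow> 'b::euclidean_space"
  assumes "S \<in> lmeasurable" "f \<in> borel_measurable borel" "\<And>x. norm (f x) \<le> B"
  shows "f \<in> L2 S"
proof -
  interpret finite_measure "lebesgue_on S" using assms(1) by (rule finite_measure_lebesgue_on)
  have f: "f \<in> borel_measurable (lebesgue_on S)"
    using assms(2) by (intro measurable_restrict_space1 measurable_completion) simp
  moreover have "integrable (lebesgue_on S) (\<lambda>x. (norm (f x))\<^sup>2)"
    using f assms(3) by (intro integrable_const_bound[where B="B\<^sup>2"]) (auto simp: power_mono)
  ultimately show ?thesis by (simp add: L2_def)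
qed

lemma lipschitz_trajectory_imp_trajectory:
  fixes g :: "'m::finite \<Rightarrow> real^'d::finite \<Rightarrow> real^'d"
  assumes "lipschitz_trajectory \<Omega> g \<gamma>"
  shows "trajectory \<Omega> g \<gamma>"
proof -
  from assms obtain L v and u :: "real \<Rightarrow> real^'m" and F B where
    lip: "L-lipschitz_on {0..1} \<gamma>" and \<Omega>: "\<forall>t\<in>{0..1}. \<gamma> t \<in> \<Omega>"
    and F: "finite F" and meas: "v \<in> borel_measurable borel" "u \<in> borel_measurable borel"
    and B: "\<And>t. norm (v t) \<le> B" "\<And>t. norm (u t) \<le> B"
    and ode: "\<And>t. t \<in> {0<..<1} - F \<Longrightarrow> (\<gamma> has_vector_derivative v t) (at t) \<and> v t = (\<Sum>i\<in>UNIV. u t $ i *\<^sub>R g i (\<gamma> t))"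
    unfolding lipschitz_trajectory_def by blast
  have "v \<in> L2 {0<..<1}" "u \<in> L2 {0<..<1}"
    using bounded_borel_in_L2 meas B by auto
  moreover have "AE t in lebesgue_on {0<..<1}.
      (\<gamma> has_vector_derivative v t) (at t) \<and> v t = (\<Sum>i\<in>UNIV. u t $ i *\<^sub>R g i (\<gamma> t))"
  proof -
    have "F \<in> null_sets lebesgue" using F negligible_finite negligible_iff_null_sets by blast
    then have "AE t in lebesgue. t \<notin> F" by (rule AE_not_in)
    then have "AE t in lebesgue. t \<in> {0<..<1} \<longrightarrow> (\<gamma> has_vector_derivative v t) (at t) \<and> v t = (\<Sum>i\<in>UNIV. u t $ i *\<^sub>R g i (\<gamma> t))"
      by eventually_elim (use ode in blast)
    then show ?thesis by (subst AE_restrict_space_iff) auto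
  qed
  ultimately show ?thesis
    unfolding trajectory_def using lipschitz_imp_absolutely_continuous[OF lip] \<Omega> by blast
qed

lemma lipschitz_trajectory_const:
  assumes "x \<in> \<Omega>"
  shows "lipschitz_trajectory \<Omega> g (\<lambda>_. x)"
  by (rule lipschitz_trajectoryI[where F="{}" and v="\<lambda>_. 0" and u="\<lambda>_. 0" and B=0, OF lipschitz_on_constant])
     (use assms in auto)

lemma lipschitz_trajectory_join:
  fixes g :: "'m::finite \<Rightarrow> real^'d::finite \<Rightarrow> real^'d"
  assumes "lipschitz_trajectory \<Omega> g \<gamma>1" "lipschitz_trajectory \<Omega> g \<gamma>2" and meet: "\<gamma>1 1 = \<gamma>2 0"
  shows "lipschitz_trajectory \<Omega> g (\<lambda>t. if t \<le> 1/2 then \<gamma>1 (2 * t) else \<gamma>2 (2 * t - 1))"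
    (is "lipschitz_trajectory \<Omega> g ?\<gamma>")
proof -
  from assms(1) obtain L1 v1 and u1 :: "real \<Rightarrow> real^'m" and F1 B1 where
    lip1: "L1-lipschitz_on {0..1} \<gamma>1" and \<Omega>1: "\<And>t. t\<in>{0..1} \<Longrightarrow> \<gamma>1 t \<in> \<Omega>"
    and F1: "finite F1" and meas1 [measurable]: "v1 \<in> borel_measurable borel" "u1 \<in> borel_measurable borel"
    and B1: "\<And>t. norm (v1 t) \<le> B1" "\<And>t. norm (u1 t) \<le> B1"
    and ode1: "\<And>t. t \<in> {0<..<1} - F1 \<Longrightarrow> (\<gamma>1 has_vector_derivative v1 t) (at t) \<and> v1 t = (\<Sum>i\<in>UNIV. u1 t $ i *\<^sub>R g i (\<gamma>1 t))"
    unfolding lipschitz_trajectory_def by blast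
  from assms(2) obtain L2 v2 and u2 :: "real \<Rightarrow> real^'m" and F2 B2 where
    lip2: "L2-lipschitz_on {0..1} \<gamma>2" and \<Omega>2: "\<And>t. t\<in>{0..1} \<Longrightarrow> \<gamma>2 t \<in> \<Omega>"
    and F2: "finite F2" and meas2 [measurable]: "v2 \<in> borel_measurable borel" "u2 \<in> borel_measurable borel"
    and B2: "\<And>t. norm (v2 t) \<le> B2" "\<And>t. norm (u2 t) \<le> B2"
    and ode2: "\<And>t. t \<in> {0<..<1} - F2 \<Longrightarrow> (\<gamma>2 has_vector_derivative v2 t) (at t) \<and> v2 t = (\<Sum>i\<in>UNIV. u2 t $ i *\<^sub>R g i (\<gamma>2 t))"
    unfolding lipschitz_trajectory_def by blast
  define L where "L = 2 * max L1 L2"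
  have L0: "0 \<le> L1" "0 \<le> L2" using lip1 lip2 lipschitz_on_nonneg by blast+
  have lip: "L-lipschitz_on {0..1} ?\<gamma>"
  proof (rule lipschitz_on_concat)
    show "L-lipschitz_on {0..1/2} (\<lambda>t. \<gamma>1 (2 * t))"
    proof (rule lipschitz_onI)
      fix s t :: real assume "s \<in> {0..1/2}" "t \<in> {0..1/2}"
      then have "dist (\<gamma>1 (2 * s)) (\<gamma>1 (2 * t)) \<le> L1 * dist (2 * s) (2 * t)"
        by (intro lipschitz_onD[OF lip1]) auto
      also have "\<dots> = (2 * L1) * dist s t"
        unfolding dist_real_def by (simp add: abs_if)
      also have "\<dots> \<le> L * dist s t" by (intro mult_right_mono) (auto simp: L_def)
      finally show "dist (\<gamma>1 (2 * s)) (\<gamma>1 (2 * t)) \<le> L * dist s t" .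
    qed (use L0 in \<open>auto simp: L_def\<close>)
    show "L-lipschitz_on {1/2..1} (\<lambda>t. \<gamma>2 (2 * t - 1))"
    proof (rule lipschitz_onI)
      fix s t :: real assume "s \<in> {1/2..1}" "t \<in> {1/2..1}"
      then have "dist (\<gamma>2 (2 * s - 1)) (\<gamma>2 (2 * t - 1)) \<le> L2 * dist (2 * s - 1) (2 * t - 1)"
        by (intro lipschitz_onD[OF lip2]) auto
      also have "\<dots> = (2 * L2) * dist s t"
        unfolding dist_real_def by (simp add: abs_if)
      also have "\<dots> \<le> L * dist s t" by (intro mult_right_mono) (auto simp: L_def)
      finally show "dist (\<gamma>2 (2 * s - 1)) (\<gamma>2 (2 * t - 1)) \<le> L * dist s t" .
    qed (use L0 in \<open>auto simp: L_def\<close>)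
  qed (use meet in auto)
  have \<Omega>: "?\<gamma> t \<in> \<Omega>" if "t \<in> {0..1}" for t using that \<Omega>1[of "2 * t"] \<Omega>2[of "2 * t - 1"] by auto
  define v where "v t = (if t \<le> 1/2 then 2 *\<^sub>R v1 (2 * t) else 2 *\<^sub>R v2 (2 * t - 1))" for t
  define u where "u t = (if t \<le> 1/2 then 2 *\<^sub>R u1 (2 * t) else 2 *\<^sub>R u2 (2 * t - 1))" for t
  define F where "F = {1/2} \<union> (\<lambda>s. s / 2) ` F1 \<union> (\<lambda>s. (s + 1) / 2) ` F2"
  define B where "B = 2 * max B1 B2"
  have F: "finite F" using F1 F2 by (simp add: F_def)
  have meas: "v \<in> borel_measurable borel" "u \<in> borel_measurable borel"
    unfolding v_def[abs_def] u_def[abs_def] by measurable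
  have B: "norm (v t) \<le> B" "norm (u t) \<le> B" for t
    using B1[of "2 * t"] B2[of "2 * t - 1"] by (auto simp: v_def u_def B_def)
  have ode: "(?\<gamma> has_vector_derivative v t) (at t) \<and> v t = (\<Sum>i\<in>UNIV. u t $ i *\<^sub>R g i (?\<gamma> t))"
    if t: "t \<in> {0<..<1} - F" for t
  proof (cases "t < 1/2")
    case True
    have "2 * t \<in> {0<..<1} - F1"
      using t True imageI[of "2 * t" F1 "\<lambda>s. s / 2"] by (auto simp: F_def)
    note ode = ode1[OF this]
    have "((\<gamma>1 \<circ> (\<lambda>t. 2 * t)) has_vector_derivative 2 *\<^sub>R v1 (2 * t)) (at t)"
      by (rule vector_diff_chain_at) (use ode in \<open>auto intro!: derivative_eq_intros\<close>)
    then have "(?\<gamma> has_vector_derivative 2 *\<^sub>R v1 (2 * t)) (at t)"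
      by (rule has_vector_derivative_transform_within_open[where S="{..<1/2}"]) (use True in auto)
    then show ?thesis using True ode by (simp add: v_def u_def scaleR_sum_right)
  next
    case False
    then have t2: "t > 1/2" using t by (cases "t = 1/2") (auto simp: F_def)
    have "2 * t - 1 \<in> {0<..<1} - F2"
      using t t2 imageI[of "2 * t - 1" F2 "\<lambda>s. (s + 1) / 2"] by (auto simp: F_def)
    note ode = ode2[OF this]
    have "((\<gamma>2 \<circ> (\<lambda>t. 2 * t - 1)) has_vector_derivative 2 *\<^sub>R v2 (2 * t - 1)) (at t)"
      by (rule vector_diff_chain_at) (use ode in \<open>auto intro!: derivative_eq_intros\<close>)
    then have "(?\<gamma> has_vector_derivative 2 *\<^sub>R v2 (2 * t - 1)) (at t)"
      by (rule has_vector_derivative_transform_within_open[where S="{1/2<..}"]) (use t2 in auto)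
    then show ?thesis using t2 ode by (simp add: v_def u_def scaleR_sum_right)
  qed
  show ?thesis by (rule lipschitz_trajectoryI[OF lip \<Omega> F meas B ode])
qed

text \<open>
  The reversed curve has velocity \<open>- a g\<^sub>i\<close>, that is, control \<open>- a\<close> in direction \<open>i\<close> and zero otherwise.
\<close>

lemma lipschitz_trajectory_reversed_integral_curve:
  fixes g :: "'m::finite \<Rightarrow> real^'d::finite \<Rightarrow> real^'d"
  assumes contk: "continuous_on UNIV k" and \<gamma>: "integral_curve k \<gamma>"
    and \<Omega>: "\<And>t. t \<in> {0..1} \<Longrightarrow> \<gamma> t \<in> \<Omega>"
    and k: "\<And>x. k x = a x *\<^sub>R g i x" and conta: "continuous_on UNIV a"
  shows "lipschitz_trajectory \<Omega> g (\<lambda>t. \<gamma> (1 - t))"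
proof -
  have deriv: "(\<gamma> has_vector_derivative k (\<gamma> s)) (at s within {0..1})" if "s \<in> {0..1}" for s
    using \<gamma> that unfolding integral_curve_def by blast
  have cont: "continuous_on {0..1} (\<lambda>t. \<gamma> (1 - t))"
    by (rule continuous_on_compose2[OF integral_curve_continuous[OF \<gamma>]]) (auto intro!: continuous_intros)
  define v where "v t = indicator {0..1} t *\<^sub>R - k (\<gamma> (1 - t))" for t :: real
  define u where "u t = indicator {0..1} t *\<^sub>R (- a (\<gamma> (1 - t)) *\<^sub>R axis i 1 :: real^'m)" for t :: real
  have contv: "continuous_on {0..1} (\<lambda>t. - k (\<gamma> (1 - t)))"
    by (intro continuous_intros continuous_on_compose2[OF contk cont]) auto
  have contu: "continuous_on {0..1} (\<lambda>t. - a (\<gamma> (1 - t)) *\<^sub>R axis i 1 :: real^'m)"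
    by (intro continuous_intros continuous_on_compose2[OF conta cont]) auto
  have meas: "v \<in> borel_measurable borel" "u \<in> borel_measurable borel"
    unfolding v_def[abs_def] u_def[abs_def]
    by (intro borel_measurable_continuous_on_indicator contv contu; simp)+
  have bdd: "bounded ((\<lambda>t. - k (\<gamma> (1 - t))) ` {0..1})" "bounded ((\<lambda>t. - a (\<gamma> (1 - t)) *\<^sub>R axis i 1 :: real^'m) ` {0..1})"
    by (intro compact_imp_bounded compact_continuous_image contv contu compact_Icc)+
  obtain B1 where B1: "\<And>t. t \<in> {0..1} \<Longrightarrow> norm (- k (\<gamma> (1 - t))) \<le> B1"
    using bdd(1) unfolding bounded_iff by blast
  obtain B2 where B2: "\<And>t. t \<in> {0..1} \<Longrightarrow> norm (- a (\<gamma> (1 - t)) *\<^sub>R axis i 1 :: real^'m) \<le> B2"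
    using bdd(2) unfolding bounded_iff by blast
  define B where "B = max 0 (max B1 B2)"
  have B: "norm (v t) \<le> B" "norm (u t) \<le> B" for t
    using B1[of t] B2[of t] by (auto simp: v_def u_def B_def indicator_def simp del: norm_scaleR)
  have lip: "B-lipschitz_on {0..1} (\<lambda>t. \<gamma> (1 - t))"
  proof (rule lipschitz_onI)
    fix s t :: real assume st: "s \<in> {0..1}" "t \<in> {0..1}"
    have "norm (\<gamma> (1 - s) - \<gamma> (1 - t)) \<le> B * \<bar>(1 - s) - (1 - t)\<bar>"
    proof (rule unit_interval_increment_bound[OF deriv])
      fix q :: real assume "q \<in> {0..1}"
      then show "norm (k (\<gamma> q)) \<le> B" using B1[of "1 - q"] by (auto simp: B_def)
    qed (use st in auto)
    then show "dist (\<gamma> (1 - s)) (\<gamma> (1 - t)) \<le> B * dist s t"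
      by (simp add: dist_norm abs_minus_commute)
  qed (simp add: B_def)
  have \<Omega>': "\<gamma> (1 - t) \<in> \<Omega>" if "t \<in> {0..1}" for t using that \<Omega> by auto
  have ode: "((\<lambda>t. \<gamma> (1 - t)) has_vector_derivative v t) (at t) \<and> v t = (\<Sum>j\<in>UNIV. u t $ j *\<^sub>R g j (\<gamma> (1 - t)))"
    if t: "t \<in> {0<..<1} - {}" for t
  proof
    have "(\<gamma> has_vector_derivative k (\<gamma> (1 - t))) (at (1 - t))"
      using deriv[of "1 - t"] t at_within_interior[of "1 - t" "{0..1}"] by simp
    then have "((\<gamma> \<circ> (\<lambda>t. 1 - t)) has_vector_derivative (-1) *\<^sub>R k (\<gamma> (1 - t))) (at t)"
      by (intro vector_diff_chain_at) (auto intro!: derivative_eq_intros)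
    then show "((\<lambda>t. \<gamma> (1 - t)) has_vector_derivative v t) (at t)"
      using t by (simp add: v_def o_def)
    have "(\<Sum>j\<in>UNIV. u t $ j *\<^sub>R g j (\<gamma> (1 - t))) = (\<Sum>j\<in>UNIV. if j = i then - a (\<gamma> (1 - t)) *\<^sub>R g i (\<gamma> (1 - t)) else 0)"
      using t by (intro sum.cong) (auto simp: u_def axis_def)
    then show "v t = (\<Sum>j\<in>UNIV. u t $ j *\<^sub>R g j (\<gamma> (1 - t)))"
      using t by (simp add: v_def k)
  qed
  show ?thesis by (rule lipschitz_trajectoryI[OF lip \<Omega>' finite.emptyI meas B ode])
qed

section \<open>Vector fields cut off by test functions\<close>

lemma has_derivative_partial_derivs:
  fixes f :: "real^'d::finite \<Rightarrow> real"
  assumes "f differentiable (at x)"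
  shows "(f has_derivative (\<lambda>v. \<Sum>l\<in>UNIV. partial_deriv l f x * v $ l)) (at x)"
proof -
  let ?D = "frechet_derivative f (at x)"
  have D: "(f has_derivative ?D) (at x)" using assms frechet_derivative_works by blast
  have lin: "linear ?D" using D has_derivative_linear by blast
  have "?D v = (\<Sum>l\<in>UNIV. partial_deriv l f x * v $ l)" for v
  proof -
    have "?D v = ?D (\<Sum>l\<in>UNIV. v $ l *\<^sub>R axis l 1)"
      using basis_expansion[of v] by (simp add: scalar_mult_eq_scaleR)
    also have "\<dots> = (\<Sum>l\<in>UNIV. partial_deriv l f x * v $ l)"
      by (simp add: linear_sum[OF lin] linear_cmul[OF lin] partial_deriv_def mult.commute)
    finally show ?thesis .
  qed
  then have "?D = (\<lambda>v. \<Sum>l\<in>UNIV. partial_deriv l f x * v $ l)" by (rule ext)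
  then show ?thesis using D by (simp only:)
qed

lemma partial_deriv_eq:
  assumes "(f has_derivative f') (at x)"
  shows "partial_deriv l f x = f' (axis l 1)"
  using frechet_derivative_at[OF assms] by (simp add: partial_deriv_def)

lemma Ck_on_first_order:
  assumes "Ck_on k S f" "1 \<le> k"
  shows "f differentiable_on S" "continuous_on S f" "continuous_on S (partial_deriv l f)"
proof -
  have "length [] < k" "length [] \<le> k" "length [l] \<le> k" using assms(2) by auto
  then have "partial_derivs [] f differentiable_on S" "continuous_on S (partial_derivs [] f)"
      "continuous_on S (partial_derivs [l] f)"
    using assms(1) unfolding Ck_on_def by blast+
  then show "f differentiable_on S" "continuous_on S f" "continuous_on S (partial_deriv l f)"
    by (simp_all add: partial_derivs_def)
qed

definition jacobian :: "(real^'d::finite \<Rightarrow> real^'d) \<Rightarrow> real^'d \<Rightarrow> real^'d^'d" where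
  "jacobian k x = (\<chi> j l. partial_deriv l (\<lambda>z. k z $ j) x)"

text \<open>
  Nothing is known about \<open>X\<close> outside \<open>\<Omega>\<close>, but there \<open>\<phi> X\<close> vanishes. So everything is checked on
  the two open sets \<open>\<Omega>\<close> (product rule) and the complement of the support of \<open>\<phi>\<close> (locally zero), which
  cover the space.
\<close>

lemma cutoff_field_regular:
  fixes X :: "real^'d::finite \<Rightarrow> real^'d"
  assumes X: "\<And>j. Ck_on 1 \<Omega> (\<lambda>x. X x $ j)" and "open \<Omega>" and \<phi>: "\<phi> \<in> test_functions \<Omega>"
  shows "((\<lambda>x. \<phi> x *\<^sub>R X x) has_derivative (*v) (jacobian (\<lambda>x. \<phi> x *\<^sub>R X x) x)) (at x)"
    and "continuous_on UNIV (jacobian (\<lambda>x. \<phi> x *\<^sub>R X x))"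
    and "x \<notin> closure {x. \<phi> x \<noteq> 0} \<Longrightarrow> jacobian (\<lambda>x. \<phi> x *\<^sub>R X x) x = 0"
    and "trace (jacobian (\<lambda>x. \<phi> x *\<^sub>R X x) x) = - adjoint_deriv X \<phi> x"
proof -
  let ?k = "\<lambda>j x. \<phi> x * X x $ j"
  define S where "S = closure {x. \<phi> x \<noteq> 0}"
  have "open (- S)" and S\<Omega>: "S \<subseteq> \<Omega>" using \<phi> by (auto simp: S_def test_functions_def)
  have "Ck_on 1 UNIV \<phi>" using \<phi> by (simp add: test_functions_def)
  note \<phi>C1 = Ck_on_first_order[OF this order_refl]
  note XC1 = Ck_on_first_order[OF X order_refl]
  have out: "(?k j has_derivative (\<lambda>_. 0)) (at x)" if "x \<in> - S" for j x
  proof (rule has_derivative_transform_within_open[OF _ \<open>open (- S)\<close> that])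
    show "((\<lambda>_. 0) has_derivative (\<lambda>_. 0)) (at x)" by simp
    show "0 = ?k j z" if "z \<in> - S" for z
      using that closure_subset[of "{x. \<phi> x \<noteq> 0}"] by (auto simp: S_def)
  qed
  have inside: "(?k j has_derivative (\<lambda>v. \<phi> x * (\<Sum>l\<in>UNIV. partial_deriv l (\<lambda>x. X x $ j) x * v $ l)
       + (\<Sum>l\<in>UNIV. partial_deriv l \<phi> x * v $ l) * X x $ j)) (at x)" if "x \<in> \<Omega>" for j x
  proof (rule has_derivative_mult; rule has_derivative_partial_derivs)
    show "\<phi> differentiable (at x)" using \<phi>C1(1) by (simp add: differentiable_on_def)
    show "(\<lambda>x. X x $ j) differentiable (at x)"
      using XC1(1) that \<open>open \<Omega>\<close> by (simp add: differentiable_on_eq_differentiable_at)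
  qed
  have diff: "?k j differentiable (at x)" for j x
    using out[of x j] inside[of x j] S\<Omega> unfolding differentiable_def by blast
  have "((\<lambda>x. \<phi> x *\<^sub>R X x) has_derivative (\<lambda>v. \<chi> j. \<Sum>l\<in>UNIV. partial_deriv l (?k j) x * v $ l)) (at x)"
    using has_derivative_partial_derivs[OF diff]
    by (subst has_derivative_componentwise_within) (auto simp: Basis_vec_def inner_axis)
  then show "((\<lambda>x. \<phi> x *\<^sub>R X x) has_derivative (*v) (jacobian (\<lambda>x. \<phi> x *\<^sub>R X x) x)) (at x)"
    by (simp add: matrix_vector_mult_def[abs_def] jacobian_def)
  have pin: "partial_deriv l (?k j) x = \<phi> x * partial_deriv l (\<lambda>x. X x $ j) x + partial_deriv l \<phi> x * X x $ j"
    if "x \<in> \<Omega>" for l j x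
    unfolding partial_deriv_eq[OF inside[OF that]] by (simp add: axis_def if_distrib cong: if_cong)
  have pout: "partial_deriv l (?k j) x = 0" if "x \<in> - S" for l j x
    using partial_deriv_eq[OF out[OF that]] .
  have "continuous_on \<Omega> (partial_deriv l (?k j))" for l j
  proof (subst continuous_on_cong[OF refl pin])
    show "continuous_on \<Omega> (\<lambda>x. \<phi> x * partial_deriv l (\<lambda>x. X x $ j) x + partial_deriv l \<phi> x * X x $ j)"
      by (intro continuous_intros XC1 continuous_on_subset[OF \<phi>C1(2)] continuous_on_subset[OF \<phi>C1(3)]) auto
  qed
  moreover have "continuous_on (- S) (partial_deriv l (?k j))" for l j
    by (subst continuous_on_cong[OF refl pout]) auto
  ultimately have "continuous_on (\<Omega> \<union> - S) (partial_deriv l (?k j))" for l j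
    by (rule continuous_on_open_Un[OF \<open>open \<Omega>\<close> \<open>open (- S)\<close>])
  moreover have "\<Omega> \<union> - S = UNIV" using S\<Omega> by auto
  ultimately have "continuous_on UNIV (partial_deriv l (?k j))" for l j by simp
  then show "continuous_on UNIV (jacobian (\<lambda>x. \<phi> x *\<^sub>R X x))"
    unfolding jacobian_def[abs_def] by (auto intro!: continuous_intros)
  show "jacobian (\<lambda>x. \<phi> x *\<^sub>R X x) x = 0" if "x \<notin> closure {x. \<phi> x \<noteq> 0}"
    using that pout by (simp add: jacobian_def vec_eq_iff S_def)
  show "trace (jacobian (\<lambda>x. \<phi> x *\<^sub>R X x) x) = - adjoint_deriv X \<phi> x"
    by (simp add: trace_def jacobian_def adjoint_deriv_def mult.commute)
qed

lemma test_function_zero_outside: "\<phi> \<in> test_functions \<Omega> \<Longrightarrow> x \<notin> \<Omega> \<Longrightarrow> \<phi> x = 0"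
  using closure_subset[of "{x. \<phi> x \<noteq> 0}"] by (auto simp: test_functions_def)

lemma time_one_map_cutoff_in:
  assumes "\<phi> \<in> test_functions \<Omega>" "(1/2)-lipschitz_on UNIV (\<lambda>z. (c * \<phi> z) *\<^sub>R X z)" "x \<in> \<Omega>"
  shows "time_one_map (\<lambda>z. (c * \<phi> z) *\<^sub>R X z) x \<in> \<Omega>"
proof -
  obtain \<gamma> where "integral_curve (\<lambda>z. (c * \<phi> z) *\<^sub>R X z) \<gamma>" "\<gamma> 0 = x"
    "\<gamma> 1 = time_one_map (\<lambda>z. (c * \<phi> z) *\<^sub>R X z) x"
    using time_one_mapE[OF assms(2)] by auto
  then show ?thesis
    using integral_curve_stays_in[OF assms(2) _ _ _, of \<gamma> \<Omega> 1] assms(3)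
      test_function_zero_outside[OF assms(1)] by auto
qed

text \<open>
  This says that the indicator of the invariant set \<open>A\<close> has weak derivative zero along \<open>X\<close>. Both signs of the
  parameter \<open>c\<close> are admitted, so \<open>integral_divergence_nonpos\<close> applies to every multiple of \<open>\<phi> X\<close>,
  in particular to the two opposite fields.
\<close>

lemma integral_adjoint_deriv_eq_0:
  fixes X :: "real^'d::finite \<Rightarrow> real^'d"
  assumes X: "\<And>j. Ck_on 1 \<Omega> (\<lambda>x. X x $ j)" and "open \<Omega>" and \<phi>: "\<phi> \<in> test_functions \<Omega>"
    and A: "open A" "bounded A"
    and inv: "\<And>c. (1/2)-lipschitz_on UNIV (\<lambda>z. (c * \<phi> z) *\<^sub>R X z) \<Longrightarrow>
      time_one_map (\<lambda>z. (c * \<phi> z) *\<^sub>R X z) ` A \<subseteq> A"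
  shows "integral A (adjoint_deriv X \<phi>) = 0"
proof -
  let ?k = "\<lambda>x. \<phi> x *\<^sub>R X x"
  note reg = cutoff_field_regular[OF X \<open>open \<Omega>\<close> \<phi>]
  have "s * integral A (adjoint_deriv X \<phi>) \<ge> 0" for s
  proof -
    have "integral A (\<lambda>x. trace (s *\<^sub>R jacobian ?k x)) \<le> 0"
    proof (rule integral_divergence_nonpos[where k="\<lambda>x. s *\<^sub>R ?k x" and S="closure {x. \<phi> x \<noteq> 0}"])
      show "((\<lambda>x. s *\<^sub>R ?k x) has_derivative (*v) (s *\<^sub>R jacobian ?k x)) (at x)" for x
        using has_derivative_scaleR_right[OF reg(1), of s x] by (simp add: scaleR_matrix_vector_assoc)
      show "continuous_on UNIV (\<lambda>x. s *\<^sub>R jacobian ?k x)" by (intro continuous_intros reg(2))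
      show "compact (closure {x. \<phi> x \<noteq> 0})" using \<phi> by (simp add: test_functions_def)
      show "s *\<^sub>R ?k x = 0" if "x \<notin> closure {x. \<phi> x \<noteq> 0}" for x
        using that closure_subset[of "{x. \<phi> x \<noteq> 0}"] by auto
      show "s *\<^sub>R jacobian ?k x = 0" if "x \<notin> closure {x. \<phi> x \<noteq> 0}" for x
        using reg(3)[OF that] by simp
      show "time_one_map (\<lambda>x. t *\<^sub>R s *\<^sub>R ?k x) ` A \<subseteq> A"
        if "(1/2)-lipschitz_on UNIV (\<lambda>x. t *\<^sub>R s *\<^sub>R ?k x)" for t
        using inv[of "t * s"] that by (simp add: mult.assoc)
    qed (rule A)+
    moreover have "trace (s *\<^sub>R jacobian ?k x) = - s * adjoint_deriv X \<phi> x" for x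
      using reg(4)[of x] by (simp add: trace_def sum_distrib_left[symmetric])
    ultimately show ?thesis by simp
  qed
  from this[of 1] this[of "-1"] show ?thesis by simp
qed

section \<open>The backward orbit of a set\<close>

text \<open>
  The flow of \<open>c \<phi> g\<^sub>i\<close> leads away from \<open>x\<close>; its reversal steers the new point back to \<open>x\<close> and from there into
  \<open>B\<close>. The cut-off \<open>\<phi>\<close> keeps the flow inside \<open>\<Omega>\<close> and makes it global; the factor \<open>c\<close> scales
  the field to Lipschitz constant at most \<open>1/2\<close>, so that its time-one map takes open sets to open sets.
\<close>

inductive_set backward_orbit ::
  "(real^'d::finite) set \<Rightarrow> ('m::finite \<Rightarrow> real^'d \<Rightarrow> real^'d) \<Rightarrow> (real^'d) set \<Rightarrow> (real^'d) set"
  for \<Omega> g B where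
    base: "x \<in> \<Omega> \<Longrightarrow> x \<in> B \<Longrightarrow> x \<in> backward_orbit \<Omega> g B"
  | step: "x \<in> backward_orbit \<Omega> g B \<Longrightarrow> \<phi> \<in> test_functions \<Omega> \<Longrightarrow>
      (1/2)-lipschitz_on UNIV (\<lambda>z. (c * \<phi> z) *\<^sub>R g i z) \<Longrightarrow>
      time_one_map (\<lambda>z. (c * \<phi> z) *\<^sub>R g i z) x \<in> backward_orbit \<Omega> g B"

lemma backward_orbit_trajectory:
  fixes g :: "'m::finite \<Rightarrow> real^'d::finite \<Rightarrow> real^'d"
  assumes "x \<in> backward_orbit \<Omega> g B"
  shows "x \<in> \<Omega> \<and> (\<exists>\<gamma>. lipschitz_trajectory \<Omega> g \<gamma> \<and> \<gamma> 0 = x \<and> \<gamma> 1 \<in> B)"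
  using assms
proof induction
  case (base x)
  then show ?case using lipschitz_trajectory_const by blast
next
  case (step x \<phi> c i)
  let ?k = "\<lambda>z. (c * \<phi> z) *\<^sub>R g i z"
  obtain \<gamma>2 where \<gamma>2: "lipschitz_trajectory \<Omega> g \<gamma>2" "\<gamma>2 0 = x" "\<gamma>2 1 \<in> B" using step.IH by blast
  obtain \<gamma> where \<gamma>: "integral_curve ?k \<gamma>" "\<gamma> 0 = x" "\<gamma> 1 = time_one_map ?k x"
    using time_one_mapE[OF step.hyps(3)] by auto
  have \<Omega>: "\<gamma> t \<in> \<Omega>" if "t \<in> {0..1}" for t
    using integral_curve_stays_in[OF step.hyps(3) _ \<gamma>(1) _ _ that, of \<Omega>] step.IH \<gamma>(2)
      test_function_zero_outside[OF step.hyps(2)] by auto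
  have cont: "continuous_on UNIV (\<lambda>z. c * \<phi> z)"
    using step.hyps(2) Ck_on_first_order(2)[of 1 UNIV \<phi>]
    by (auto simp: test_functions_def intro!: continuous_intros)
  have "lipschitz_trajectory \<Omega> g (\<lambda>t. \<gamma> (1 - t))"
    by (rule lipschitz_trajectory_reversed_integral_curve[where k="?k" and a="\<lambda>z. c * \<phi> z" and i=i])
       (fact lipschitz_on_continuous_on[OF step.hyps(3)] \<gamma>(1) \<Omega> refl cont)+
  from lipschitz_trajectory_join[OF this \<gamma>2(1)]
  have "lipschitz_trajectory \<Omega> g (\<lambda>t. if t \<le> 1/2 then \<gamma> (1 - 2 * t) else \<gamma>2 (2 * t - 1))"
    using \<gamma>(2) \<gamma>2(2) by simp
  moreover have "time_one_map ?k x \<in> \<Omega>" using \<Omega>[of 1] \<gamma>(3) by simp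
  ultimately show ?case using \<gamma>(3) \<gamma>2(3) by force
qed

lemma backward_orbit_subset: "backward_orbit \<Omega> g B \<subseteq> \<Omega>"
  using backward_orbit_trajectory by blast

lemma backward_orbit_subset_Reach_inv: "backward_orbit \<Omega> g B \<subseteq> Reach_inv \<Omega> g B"
  using backward_orbit_trajectory lipschitz_trajectory_imp_trajectory unfolding Reach_inv_def by blast

text \<open>
  Openness propagates along a step because time-one maps are open.
\<close>

lemma open_backward_orbit:
  assumes "open \<Omega>" "open B"
  shows "open (backward_orbit \<Omega> g B)"
proof -
  have "\<exists>V. open V \<and> x \<in> V \<and> V \<subseteq> backward_orbit \<Omega> g B" if "x \<in> backward_orbit \<Omega> g B" for x
    using that
  proof induction
    case (base x)
    then show ?case using assms
      by (intro exI[of _ "\<Omega> \<inter> B"]) (auto intro: backward_orbit.base)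
  next
    case (step x \<phi> c i)
    let ?k = "\<lambda>z. (c * \<phi> z) *\<^sub>R g i z"
    obtain V where V: "open V" "x \<in> V" "V \<subseteq> backward_orbit \<Omega> g B" using step.IH by blast
    have "open (time_one_map ?k ` V)" using open_image_time_one_map[OF step.hyps(3) _ V(1)] by simp
    moreover have "time_one_map ?k v \<in> backward_orbit \<Omega> g B" if "v \<in> V" for v
      using V(3) that step.hyps(2,3) by (intro backward_orbit.step[where i=i and \<phi>=\<phi> and c=c]) auto
    ultimately show ?case using V(2) by blast
  qed
  then show ?thesis using open_subopen by blast
qed

section \<open>Full measure of the reachability set\<close>

lemma integrable_lebesgue_on_bounded_borel:
  fixes h :: "'a::euclidean_space \<Rightarrow> real"
  assumes "S \<in> lmeasurable" "h \<in> borel_measurable borel" "\<And>x. \<bar>h x\<bar> \<le> B"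
  shows "integrable (lebesgue_on S) h"
proof -
  interpret finite_measure "lebesgue_on S" using assms(1) by (rule finite_measure_lebesgue_on)
  have "h \<in> borel_measurable (lebesgue_on S)"
    using assms(2) by (intro measurable_restrict_space1 measurable_completion) simp
  then show ?thesis using assms(3) by (intro integrable_const_bound[where B=B]) auto
qed

lemma adjoint_deriv_bounded_continuous:
  fixes X :: "real^'d::finite \<Rightarrow> real^'d"
  assumes X: "\<And>j. Ck_on 1 \<Omega> (\<lambda>x. X x $ j)" and "open \<Omega>" and \<phi>: "\<phi> \<in> test_functions \<Omega>"
  shows "continuous_on UNIV (adjoint_deriv X \<phi>)" "\<exists>B. \<forall>x. \<bar>adjoint_deriv X \<phi> x\<bar> \<le> B"
proof -
  let ?J = "jacobian (\<lambda>x. \<phi> x *\<^sub>R X x)" and ?S = "closure {x. \<phi> x \<noteq> 0}"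
  note reg = cutoff_field_regular[OF X \<open>open \<Omega>\<close> \<phi>]
  have eq: "adjoint_deriv X \<phi> x = - (\<Sum>i\<in>UNIV. ?J x $ i $ i)" for x
    using reg(4)[of x] by (simp add: trace_def)
  show cont: "continuous_on UNIV (adjoint_deriv X \<phi>)"
    unfolding eq[abs_def] by (intro continuous_intros reg(2))
  have "compact ?S" using \<phi> by (simp add: test_functions_def)
  then have "bounded (adjoint_deriv X \<phi> ` ?S)"
    by (intro compact_imp_bounded compact_continuous_image continuous_on_subset[OF cont]) auto
  then obtain B where B: "\<And>x. x \<in> ?S \<Longrightarrow> \<bar>adjoint_deriv X \<phi> x\<bar> \<le> B"
    unfolding bounded_iff by auto
  have "\<bar>adjoint_deriv X \<phi> x\<bar> \<le> max B 0" for x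
    using B[of x] reg(3)[of x] by (cases "x \<in> ?S") (auto simp: eq)
  then show "\<exists>B. \<forall>x. \<bar>adjoint_deriv X \<phi> x\<bar> \<le> B" by blast
qed

theorem corollary1:
  fixes \<Omega> :: "(real^'d::finite) set"
    and g :: "'m::finite \<Rightarrow> real^'d \<Rightarrow> real^'d"
    and lam R :: real and y :: "real^'d"
  assumes "\<Omega> \<noteq> {}" and "bounded \<Omega>" and "open \<Omega>"
    and "CARD('m) \<le> CARD('d)"
    and "\<And>i j. Ck_on_closure 2 \<Omega> (\<lambda>x. g i x $ j)"
    and "lam > 0"
    and poincare: "\<And>f w. f \<in> WH1_perp \<Omega> g \<Longrightarrow> (\<And>i. has_weak_deriv_along \<Omega> (g i) f (w i)) \<Longrightarrow>
           (LINT x|lebesgue_on \<Omega>. \<bar>f x\<bar>\<^sup>2) \<le>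
             1 / lam * (LINT x|lebesgue_on \<Omega>. (\<Sum>i\<in>UNIV. \<bar>w i x\<bar>\<^sup>2))"
    and "R > 0" and "y \<in> \<Omega>"
  shows "\<Omega> - Reach_inv \<Omega> g (ball y R) \<in> null_sets lebesgue"
proof -
  have gC1: "Ck_on 1 \<Omega> (\<lambda>x. g i x $ j)" for i j
    using assms(5)[of i j] unfolding Ck_on_closure_def Ck_on_def by auto
  define A where "A = backward_orbit \<Omega> g (ball y R)"
  have "open A" unfolding A_def by (rule open_backward_orbit[OF \<open>open \<Omega>\<close> open_ball])
  have A\<Omega>: "A \<subseteq> \<Omega>" unfolding A_def by (rule backward_orbit_subset)
  have "y \<in> A" unfolding A_def using assms(8,9) by (intro backward_orbit.base) auto
  have "bounded A" using A\<Omega> \<open>bounded \<Omega>\<close> bounded_subset by blast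
  have Am: "A \<in> lmeasurable" and \<Omega>m: "\<Omega> \<in> lmeasurable"
    using \<open>open A\<close> \<open>bounded A\<close> assms(2,3) by (auto intro: lmeasurable_open)
  have m\<Omega>: "measure lebesgue \<Omega> > 0"
    using \<Omega>m open_not_negligible[OF \<open>open \<Omega>\<close> \<open>\<Omega> \<noteq> {}\<close>]
    by (metis negligible_iff_measure zero_less_measure_iff)
  have A0: "integral A (adjoint_deriv (g i) \<phi>) = 0" if "\<phi> \<in> test_functions \<Omega>" for i \<phi>
  proof (rule integral_adjoint_deriv_eq_0[OF gC1 \<open>open \<Omega>\<close> that \<open>open A\<close> \<open>bounded A\<close>])
    show "time_one_map (\<lambda>z. (c * \<phi> z) *\<^sub>R g i z) ` A \<subseteq> A"
      if "(1/2)-lipschitz_on UNIV (\<lambda>z. (c * \<phi> z) *\<^sub>R g i z)" for c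
      unfolding A_def using backward_orbit.step[where i=i and c=c and \<phi>=\<phi>] \<open>\<phi> \<in> test_functions \<Omega>\<close> that
      by blast
  qed
  have \<Omega>0: "integral \<Omega> (adjoint_deriv (g i) \<phi>) = 0" if "\<phi> \<in> test_functions \<Omega>" for i \<phi>
    using time_one_map_cutoff_in[OF that]
    by (intro integral_adjoint_deriv_eq_0[OF gC1 \<open>open \<Omega>\<close> that assms(3,2)]) blast
  define c where "c = measure lebesgue A / measure lebesgue \<Omega>"
  have A_borel [measurable]: "A \<in> sets borel" using \<open>open A\<close> by simp
  define f where "f x = indicator A x - c" for x
  have f_meas: "f \<in> borel_measurable borel" unfolding f_def[abs_def] by measurable
  have f_bound: "norm (f x) \<le> 1 + \<bar>c\<bar>" for x by (auto simp: f_def indicator_def)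
  have "f \<in> L2 \<Omega>" by (rule bounded_borel_in_L2[OF \<Omega>m f_meas f_bound])
  have zero_L2: "(\<lambda>_. 0) \<in> L2 \<Omega>" by (rule bounded_borel_in_L2[OF \<Omega>m, where B=0]) auto
  \<comment> \<open>Used twice: with the adjoint derivative of a test function for \<open>h\<close>, and with \<open>h = 1\<close> for the mean.\<close>
  have int_f: "(LINT x|lebesgue_on \<Omega>. f x * h x) = integral A h - c * integral \<Omega> h"
    if "h \<in> borel_measurable borel" "\<And>x. \<bar>h x\<bar> \<le> B" for h B
  proof -
    have iA: "integrable (lebesgue_on \<Omega>) (\<lambda>x. indicator A x * h x)"
    proof (rule integrable_lebesgue_on_bounded_borel[OF \<Omega>m])
      show "\<bar>indicator A x * h x\<bar> \<le> B" for x using that(2)[of x] by (auto simp: indicator_def)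
      show "(\<lambda>x. indicator A x * h x) \<in> borel_measurable borel" using that(1) by measurable
    qed
    have ih: "integrable (lebesgue_on \<Omega>) h" using integrable_lebesgue_on_bounded_borel[OF \<Omega>m that] .
    have "(LINT x|lebesgue_on \<Omega>. f x * h x) = (LINT x|lebesgue_on \<Omega>. indicator A x * h x - c * h x)"
      by (simp add: f_def algebra_simps)
    also have "\<dots> = (LINT x|lebesgue_on \<Omega>. indicator A x * h x) - c * (LINT x|lebesgue_on \<Omega>. h x)"
      using iA ih by simp
    also have "(LINT x|lebesgue_on \<Omega>. indicator A x * h x) = integral \<Omega> (\<lambda>x. indicator A x * h x)"
      using iA \<Omega>m by (intro lebesgue_integral_eq_integral) auto
    also have "\<dots> = integral \<Omega> (\<lambda>x. if x \<in> A then h x else 0)"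
      by (rule integral_cong) (simp add: indicator_def)
    also have "\<dots> = integral A h" using integral_restrict_Int[of \<Omega> A h] A\<Omega> by (simp add: Int_absorb2)
    also have "(LINT x|lebesgue_on \<Omega>. h x) = integral \<Omega> h"
      using ih \<Omega>m by (intro lebesgue_integral_eq_integral) auto
    finally show ?thesis .
  qed
  have weak: "has_weak_deriv_along \<Omega> (g i) f (\<lambda>_. 0)" for i
    unfolding has_weak_deriv_along_def
  proof (intro conjI ballI)
    fix \<phi> assume \<phi>: "\<phi> \<in> test_functions \<Omega>"
    obtain B where "continuous_on UNIV (adjoint_deriv (g i) \<phi>)" "\<And>x. \<bar>adjoint_deriv (g i) \<phi> x\<bar> \<le> B"
      using adjoint_deriv_bounded_continuous[OF gC1 \<open>open \<Omega>\<close> \<phi>] by blast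
    then show "(LINT x|lebesgue_on \<Omega>. 0 * \<phi> x) = (LINT x|lebesgue_on \<Omega>. f x * adjoint_deriv (g i) \<phi> x)"
      by (subst int_f) (auto simp: A0[OF \<phi>] \<Omega>0[OF \<phi>] borel_measurable_continuous_onI)
  qed (fact \<open>f \<in> L2 \<Omega>\<close> zero_L2)+
  have "(LINT x|lebesgue_on \<Omega>. f x) = 0"
    using int_f[of "\<lambda>_. 1" 1] m\<Omega> Am \<Omega>m by (simp add: lmeasure_integral[symmetric] c_def)
  then have "f \<in> WH1_perp \<Omega> g"
    unfolding WH1_perp_def WH1_def using weak \<open>f \<in> L2 \<Omega>\<close> by blast
  from poincare[OF this weak] have "(LINT x|lebesgue_on \<Omega>. (f x)\<^sup>2) \<le> 0" by simp
  moreover have "(LINT x|lebesgue_on \<Omega>. (f x)\<^sup>2) \<ge> 0" by simp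
  ultimately have "(LINT x|lebesgue_on \<Omega>. (f x)\<^sup>2) = 0" by linarith
  moreover have "integrable (lebesgue_on \<Omega>) (\<lambda>x. (f x)\<^sup>2)"
    using \<open>f \<in> L2 \<Omega>\<close> by (simp add: L2_def)
  ultimately have "AE x in lebesgue_on \<Omega>. f x = 0"
    by (subst (asm) integral_nonneg_eq_0_iff_AE) auto
  then have "AE x in lebesgue. x \<in> \<Omega> \<longrightarrow> f x = 0"
    using \<Omega>m by (subst (asm) AE_restrict_space_iff) auto
  then obtain N where N: "N \<in> null_sets lebesgue" "\<And>x. x \<in> \<Omega> \<Longrightarrow> x \<notin> N \<Longrightarrow> f x = 0"
    unfolding eventually_ae_filter by auto
  \<comment> \<open>A point of \<open>A\<close> outside the exceptional null set identifies the constant \<open>c\<close> as \<open>1\<close>.\<close>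
  have "\<not> negligible A" using \<open>open A\<close> \<open>y \<in> A\<close> open_not_negligible by blast
  then obtain x where "x \<in> A" "x \<notin> N"
    using N(1) negligible_iff_null_sets negligible_subset by blast
  then have "c = 1" using N(2)[of x] A\<Omega> by (auto simp: f_def)
  then have "f x \<noteq> 0" if "x \<notin> A" for x using that by (simp add: f_def)
  then have "\<Omega> - A \<subseteq> N" using N(2) by blast
  then have "\<Omega> - Reach_inv \<Omega> g (ball y R) \<subseteq> N"
    using backward_orbit_subset_Reach_inv unfolding A_def by blast
  then show ?thesis using N(1) negligible_subset unfolding negligible_iff_null_sets[symmetric] by blast
qed

end
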